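(* Let $M$ be an $r$-lightlike submanifold with $r<\min\{m,n\}$, or a coisotropic submanifold, of an $(m+n)$-dimensional semi-Riemannian manifold $(\overline{M},\overline{g})$, with induced algebraic Riemannian curvature tensor $R$. Then for any $u\in M$ and any $x\in S_u^{+}(M)$ (or $x\in S_u^{-}(M)$), $$\mathrm{trace}\,J_{R}(x)=\sum_{i=1}^{r}\eta_{i}(R(x,\xi_{i})x)-Ric(x,x),$$ where $\eta_{i}(\cdot)=\overline{g}(\cdot,N_{i})$.
   Context: $(\overline{M},\overline{g})$ is an $(m+n)$-dimensional semi-Riemannian manifold of constant index $\nu$, $1\le\nu<m+n$, $m,n\ge1$, with Levi-Civita connection $\overline{\nabla}$. $M$ is a submanifold of codimension $n$ with $g=\overline{g}|_{TM}$. $\mathrm{Rad}\,T_uM=T_uM\cap T_uM^{\perp}$. $M$ is $r$-lightlike if $u\mapsto \mathrm{Rad}\,T_uM$ is a smooth distribution of rank $r>0$; it is coisotropic if $r=n$. $M$ is endowed with a screen distribution $S(TM)$, i.e. a semi-Riemannian complement of $\mathrm{Rad}\,TM$ in $TM$, and a screen transversal bundle $S(TM^{\perp})$, i.e. a semi-Riemannian complement of $\mathrm{Rad}\,TM$ in $TM^{\perp}$ (zero in the coisotropic case). For a local frame $\{\xi_i\}_{i=1}^r$ of $\mathrm{Rad}\,TM$ there are local sections $N_i$ of the orthogonal complement of $S(TM^{\perp})$ in $S(TM)^{\perp}$ with $\overline{g}(\xi_i,N_j)=\delta_{ij}$, $\overline{g}(N_i,N_j)=0$; they span $ltr(TM)$.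 Put $tr(TM)=ltr(TM)\perp S(TM^{\perp})$, so $T\overline{M}|_M=TM\oplus tr(TM)$. The induced connection $\nabla$ is defined by $\overline{\nabla}_XY=\nabla_XY+h(X,Y)$, $\nabla_XY\in\Gamma(TM)$, $h(X,Y)\in\Gamma(tr(TM))$. Induced curvature: $R(X,Y)Z=\nabla_X\nabla_YZ-\nabla_Y\nabla_XZ-\nabla_{[X,Y]}Z$, $R(X,Y,Z,U)=g(R(X,Y)Z,U)$; induced Ricci tensor: $Ric(X,Y)=\mathrm{trace}(Z\mapsto R(X,Z)Y)$. $R$ is algebraic if at each point $R(x,y,z,w)=-R(y,x,z,w)=R(z,w,x,y)$ and $R(x,y,z,w)+R(y,z,x,w)+R(z,x,y,w)=0$. Put $\tilde g(X,Y)=g(X,Y)+\sum_{i=1}^r\eta_i(X)\eta_i(Y)$, a non-degenerate metric on $M$, and $S_u^{\pm}(M)=\{x\in T_uM:g(x,x)=\pm1\}$. For $x\in S_u^{\pm}(M)$ the pseudo-Jacobi operator $J_R(x):T_uM\to T_uM$ is the $\tilde g$-self-adjoint linear map given by $\tilde g(J_R(x)y,w)=R(y,x,x,w)$ for all $y,w\in T_uM$. *)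

theory Defs
  imports "HOL-Analysis.Analysis" "HOL-Library.Function_Algebras"
begin

section \<open>Smooth functions on open subsets of Euclidean spaces\<close>

primrec Ck_on :: "nat \<Rightarrow> 'a::real_normed_vector set \<Rightarrow> ('a \<Rightarrow> 'b::real_normed_vector) \<Rightarrow> bool" where
  "Ck_on 0 S f \<longleftrightarrow> continuous_on S f"
| "Ck_on (Suc k) S f \<longleftrightarrow>
     f differentiable_on S \<and> (\<forall>v. Ck_on k S (\<lambda>x. frechet_derivative f (at x) v))"

definition smooth_on :: "'a::real_normed_vector set \<Rightarrow> ('a \<Rightarrow> 'b::real_normed_vector) \<Rightarrow> bool" where
  "smooth_on S f \<longleftrightarrow> (\<forall>k. Ck_on k S f)"


section \<open>Linear algebra on subspaces\<close>

text \<open>Tangent vectors are operators on functions, so function types have to be real vector spaces.\<close>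

instantiation "fun" :: (type, scaleR) scaleR
begin
definition scaleR_fun_def: "r *\<^sub>R f = (\<lambda>x. r *\<^sub>R f x)"
instance ..
end

instance "fun" :: (type, real_vector) real_vector
  by standard (simp_all add: scaleR_fun_def fun_eq_iff scaleR_add_right scaleR_add_left)

definition linear_on :: "'v::real_vector set \<Rightarrow> ('v \<Rightarrow> 'w::real_vector) \<Rightarrow> bool" where
  "linear_on V f \<longleftrightarrow>
     (\<forall>x\<in>V. \<forall>y\<in>V. f (x + y) = f x + f y) \<and> (\<forall>c. \<forall>x\<in>V. f (c *\<^sub>R x) = c *\<^sub>R f x)"

text \<open>For a linear map of a finite-dimensional subspace \<open>V\<close> into itself the choice of basis is irrelevant.\<close>

definition trace_on :: "'v::real_vector set \<Rightarrow> ('v \<Rightarrow> 'v) \<Rightarrow> real" where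
  "trace_on V f = (let B = (SOME B. independent B \<and> span B = V)
                   in \<Sum>b\<in>B. representation B (f b) b)"

definition bilinear_on :: "'v::real_vector set \<Rightarrow> ('v \<Rightarrow> 'v \<Rightarrow> real) \<Rightarrow> bool" where
  "bilinear_on V b \<longleftrightarrow> (\<forall>x\<in>V. linear_on V (\<lambda>y. b x y) \<and> linear_on V (\<lambda>y. b y x))"

definition symmetric_on :: "'v set \<Rightarrow> ('v \<Rightarrow> 'v \<Rightarrow> real) \<Rightarrow> bool" where
  "symmetric_on V b \<longleftrightarrow> (\<forall>x\<in>V. \<forall>y\<in>V. b x y = b y x)"

definition nondegenerate_on :: "'v::real_vector set \<Rightarrow> ('v \<Rightarrow> 'v \<Rightarrow> real) \<Rightarrow> bool" where
  "nondegenerate_on V b \<longleftrightarrow> (\<forall>x\<in>V. (\<forall>y\<in>V. b x y = 0) \<longrightarrow> x = 0)"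

definition index_on :: "'v::real_vector set \<Rightarrow> ('v \<Rightarrow> 'v \<Rightarrow> real) \<Rightarrow> nat" where
  "index_on V b = (GREATEST k. \<exists>W. subspace W \<and> W \<subseteq> V \<and> dim W = k \<and>
                                    (\<forall>x\<in>W. x \<noteq> 0 \<longrightarrow> b x x < 0))"

definition perp_in :: "'v set \<Rightarrow> ('v \<Rightarrow> 'v \<Rightarrow> real) \<Rightarrow> 'v set \<Rightarrow> 'v set" where
  "perp_in V b E = {v\<in>V. \<forall>w\<in>E. b v w = 0}"

definition direct_sum :: "'v::real_vector set \<Rightarrow> 'v set \<Rightarrow> 'v set \<Rightarrow> bool" where
  "direct_sum E A B \<longleftrightarrow> E = {a + b |a b. a \<in> A \<and> b \<in> B} \<and> A \<inter> B = {0}"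

definition basis_family :: "nat \<Rightarrow> (nat \<Rightarrow> 'v::real_vector) \<Rightarrow> 'v set \<Rightarrow> bool" where
  "basis_family k s E \<longleftrightarrow>
     inj_on s {1..k} \<and> independent (s ` {1..k}) \<and> span (s ` {1..k}) = E"


section \<open>Smooth manifolds\<close>

text \<open>A chart is a pair of an open domain and a map that is only meaningful on that domain.\<close>

record ('p, 'e) manifold =
  mtop :: "'p topology"
  atlas :: "('p set \<times> ('p \<Rightarrow> 'e)) set"

abbreviation points :: "('p, 'e) manifold \<Rightarrow> 'p set" where
  "points M \<equiv> topspace (mtop M)"

definition smooth_manifold :: "('p, 'e::euclidean_space) manifold \<Rightarrow> bool" where
  "smooth_manifold M \<longleftrightarrow>
     Hausdorff_space (mtop M) \<and> second_countable (mtop M) \<and>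
     points M = (\<Union>(U, \<phi>)\<in>atlas M. U) \<and>
     (\<forall>(U, \<phi>)\<in>atlas M. openin (mtop M) U \<and> open (\<phi> ` U) \<and>
        homeomorphic_map (subtopology (mtop M) U) (top_of_set (\<phi> ` U)) \<phi>) \<and>
     (\<forall>(U, \<phi>)\<in>atlas M. \<forall>(V, \<psi>)\<in>atlas M. smooth_on (\<phi> ` (U \<inter> V)) (\<psi> \<circ> inv_into U \<phi>))"

definition smooth_fun :: "('p, 'e::euclidean_space) manifold \<Rightarrow> 'p set \<Rightarrow> ('p \<Rightarrow> real) \<Rightarrow> bool" where
  "smooth_fun M W f \<longleftrightarrow> openin (mtop M) W \<and>
     (\<forall>(U, \<phi>)\<in>atlas M. smooth_on (\<phi> ` (U \<inter> W)) (f \<circ> inv_into U \<phi>))"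

definition smooth_near :: "('p, 'e::euclidean_space) manifold \<Rightarrow> 'p \<Rightarrow> ('p \<Rightarrow> real) \<Rightarrow> bool" where
  "smooth_near M p f \<longleftrightarrow> (\<exists>W. p \<in> W \<and> smooth_fun M W f)"

text \<open>A tangent vector at \<open>p\<close> is a directional derivative (in a chart around \<open>p\<close>), as an operator on
  the functions that are smooth near \<open>p\<close>.  The value \<open>0\<close> on all other functions only serves to make
  the representation unique.\<close>

type_synonym 'p tvec = "('p \<Rightarrow> real) \<Rightarrow> real"

definition chart_vector ::
  "('p, 'e::euclidean_space) manifold \<Rightarrow> 'p set \<times> ('p \<Rightarrow> 'e) \<Rightarrow> 'p \<Rightarrow> 'e \<Rightarrow> 'p tvec" where
  "chart_vector M c p w = (case c of (U, \<phi>) \<Rightarrow>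
     (\<lambda>f. if smooth_near M p f then frechet_derivative (f \<circ> inv_into U \<phi>) (at (\<phi> p)) w else 0))"

definition tangent_space :: "('p, 'e::euclidean_space) manifold \<Rightarrow> 'p \<Rightarrow> 'p tvec set" where
  "tangent_space M p = {chart_vector M (U, \<phi>) p w |U \<phi> w. (U, \<phi>) \<in> atlas M \<and> p \<in> U}"

definition smooth_map ::
  "('q, 'f::euclidean_space) manifold \<Rightarrow> ('p, 'e::euclidean_space) manifold \<Rightarrow> ('q \<Rightarrow> 'p) \<Rightarrow> bool" where
  "smooth_map M N i \<longleftrightarrow> continuous_map (mtop M) (mtop N) i \<and>
     (\<forall>(U, \<phi>)\<in>atlas M. \<forall>(V, \<psi>)\<in>atlas N.
        smooth_on (\<phi> ` {p\<in>U. i p \<in> V}) (\<psi> \<circ> i \<circ> inv_into U \<phi>))"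

definition pushforward ::
  "('p, 'e::euclidean_space) manifold \<Rightarrow> ('q \<Rightarrow> 'p) \<Rightarrow> 'q \<Rightarrow> 'q tvec \<Rightarrow> 'p tvec" where
  "pushforward N i p v = (\<lambda>f. if smooth_near N (i p) f then v (f \<circ> i) else 0)"

text \<open>\<open>M\<close>, with its own topology and smooth structure, is a submanifold of \<open>N\<close> via the inclusion \<open>i\<close>.\<close>

definition immersed_submanifold ::
  "('q, 'f::euclidean_space) manifold \<Rightarrow> ('p, 'e::euclidean_space) manifold \<Rightarrow> ('q \<Rightarrow> 'p) \<Rightarrow> bool" where
  "immersed_submanifold M N i \<longleftrightarrow> smooth_map M N i \<and> inj_on i (points M) \<and>
     (\<forall>p\<in>points M. inj_on (pushforward N i p) (tangent_space M p))"

text \<open>Smooth sections over the open set \<open>W\<close> of the pull-back bundle \<open>i\<^sup>*TN\<close>, i.e. vector fields along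
  \<open>i\<close>.  For \<open>i\<close> the identity these are the vector fields on \<open>W\<close>.\<close>

definition section_on ::
  "('q, 'f::euclidean_space) manifold \<Rightarrow> ('p, 'e::euclidean_space) manifold \<Rightarrow> ('q \<Rightarrow> 'p) \<Rightarrow>
   'q set \<Rightarrow> ('q \<Rightarrow> 'p tvec) \<Rightarrow> bool" where
  "section_on M N i W V \<longleftrightarrow> openin (mtop M) W \<and> (\<forall>p\<in>W. V p \<in> tangent_space N (i p)) \<and>
     (\<forall>U f. smooth_fun N U f \<longrightarrow> smooth_fun M {p\<in>W. i p \<in> U} (\<lambda>p. V p f))"

definition section_near ::
  "('q, 'f::euclidean_space) manifold \<Rightarrow> ('p, 'e::euclidean_space) manifold \<Rightarrow> ('q \<Rightarrow> 'p) \<Rightarrow>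
   'q \<Rightarrow> ('q \<Rightarrow> 'p tvec) \<Rightarrow> bool" where
  "section_near M N i p V \<longleftrightarrow> (\<exists>W. p \<in> W \<and> section_on M N i W V)"

abbreviation vector_field_on ::
  "('p, 'e::euclidean_space) manifold \<Rightarrow> 'p set \<Rightarrow> ('p \<Rightarrow> 'p tvec) \<Rightarrow> bool" where
  "vector_field_on M \<equiv> section_on M M (\<lambda>p. p)"

abbreviation vector_field_near ::
  "('p, 'e::euclidean_space) manifold \<Rightarrow> 'p \<Rightarrow> ('p \<Rightarrow> 'p tvec) \<Rightarrow> bool" where
  "vector_field_near M \<equiv> section_near M M (\<lambda>p. p)"

definition lie_bracket ::
  "('p, 'e::euclidean_space) manifold \<Rightarrow> ('p \<Rightarrow> 'p tvec) \<Rightarrow> ('p \<Rightarrow> 'p tvec) \<Rightarrow> 'p \<Rightarrow> 'p tvec" where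
  "lie_bracket M X Y p =
     (\<lambda>f. if smooth_near M p f then X p (\<lambda>q. Y q f) - Y p (\<lambda>q. X q f) else 0)"

definition smooth_subbundle ::
  "('q, 'f::euclidean_space) manifold \<Rightarrow> ('p, 'e::euclidean_space) manifold \<Rightarrow> ('q \<Rightarrow> 'p) \<Rightarrow>
   nat \<Rightarrow> ('q \<Rightarrow> 'p tvec set) \<Rightarrow> bool" where
  "smooth_subbundle M N i k E \<longleftrightarrow> (\<forall>u\<in>points M. \<exists>W s. u \<in> W \<and> openin (mtop M) W \<and>
     (\<forall>j\<in>{1..k}. section_on M N i W (s j)) \<and>
     (\<forall>p\<in>W. basis_family k (\<lambda>j. s j p) (E p)))"


section \<open>Semi-Riemannian metrics and connections\<close>

type_synonym 'p metric_tensor = "'p \<Rightarrow> 'p tvec \<Rightarrow> 'p tvec \<Rightarrow> real"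

definition semi_riemannian_metric ::
  "('p, 'e::euclidean_space) manifold \<Rightarrow> 'p metric_tensor \<Rightarrow> nat \<Rightarrow> bool" where
  "semi_riemannian_metric N b \<nu> \<longleftrightarrow>
     (\<forall>p\<in>points N. bilinear_on (tangent_space N p) (b p) \<and>
        symmetric_on (tangent_space N p) (b p) \<and>
        nondegenerate_on (tangent_space N p) (b p) \<and>
        index_on (tangent_space N p) (b p) = \<nu>) \<and>
     (\<forall>W X Y. vector_field_on N W X \<longrightarrow> vector_field_on N W Y \<longrightarrow>
        smooth_fun N W (\<lambda>p. b p (X p) (Y p)))"

text \<open>A connection \<open>D\<close> on \<open>i\<^sup>*TN\<close>; \<open>D p x V\<close> is the derivative of the section \<open>V\<close> at \<open>p\<close> in the direction
  of \<open>x \<in> T\<^sub>pM\<close> and is meaningful if \<open>V\<close> is smooth near \<open>p\<close>.\<close>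

type_synonym ('q, 'p) connection = "'q \<Rightarrow> 'q tvec \<Rightarrow> ('q \<Rightarrow> 'p tvec) \<Rightarrow> 'p tvec"

definition connection_along ::
  "('q, 'f::euclidean_space) manifold \<Rightarrow> ('p, 'e::euclidean_space) manifold \<Rightarrow> ('q \<Rightarrow> 'p) \<Rightarrow>
   ('q, 'p) connection \<Rightarrow> bool" where
  "connection_along M N i D \<longleftrightarrow>
     (\<forall>W X V. vector_field_on M W X \<longrightarrow> section_on M N i W V \<longrightarrow>
        section_on M N i W (\<lambda>p. D p (X p) V)) \<and>
     (\<forall>p\<in>points M. \<forall>V. section_near M N i p V \<longrightarrow> linear_on (tangent_space M p) (\<lambda>x. D p x V)) \<and>
     (\<forall>p\<in>points M. \<forall>x\<in>tangent_space M p. \<forall>V V'. section_near M N i p V \<longrightarrow> section_near M N i p V' \<longrightarrow>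
        D p x (\<lambda>q. V q + V' q) = D p x V + D p x V') \<and>
     (\<forall>p\<in>points M. \<forall>x\<in>tangent_space M p. \<forall>f V. smooth_near M p f \<longrightarrow> section_near M N i p V \<longrightarrow>
        D p x (\<lambda>q. f q *\<^sub>R V q) = x f *\<^sub>R V p + f p *\<^sub>R D p x V) \<and>
     (\<forall>p\<in>points M. \<forall>x\<in>tangent_space M p. \<forall>V V' W. section_near M N i p V \<longrightarrow> section_near M N i p V' \<longrightarrow>
        openin (mtop M) W \<longrightarrow> p \<in> W \<longrightarrow> (\<forall>q\<in>W. V q = V' q) \<longrightarrow> D p x V = D p x V')"

definition levi_civita ::
  "('p, 'e::euclidean_space) manifold \<Rightarrow> 'p metric_tensor \<Rightarrow> ('p, 'p) connection \<Rightarrow> bool" where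
  "levi_civita N b D \<longleftrightarrow> connection_along N N (\<lambda>p. p) D \<and>
     (\<forall>p\<in>points N. \<forall>X Y. vector_field_near N p X \<longrightarrow> vector_field_near N p Y \<longrightarrow>
        D p (X p) Y - D p (Y p) X = lie_bracket N X Y p) \<and>
     (\<forall>p\<in>points N. \<forall>x\<in>tangent_space N p. \<forall>Y Z. vector_field_near N p Y \<longrightarrow> vector_field_near N p Z \<longrightarrow>
        x (\<lambda>q. b q (Y q) (Z q)) = b p (D p x Y) (Z p) + b p (Y p) (D p x Z))"

text \<open>The derivative \<open>D\<close> of vector fields along \<open>i\<close> induced by a connection \<open>Db\<close> of \<open>N\<close>.  It is the unique
  connection on \<open>i\<^sup>*TN\<close> that differentiates restrictions \<open>Y \<circ> i\<close> of vector fields \<open>Y\<close> of \<open>N\<close> as \<open>Db\<close>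
  does; this is what the ambient connection means for vector fields defined along \<open>M\<close> only.\<close>

definition pullback_connection ::
  "('q, 'f::euclidean_space) manifold \<Rightarrow> ('p, 'e::euclidean_space) manifold \<Rightarrow> ('q \<Rightarrow> 'p) \<Rightarrow>
   ('p, 'p) connection \<Rightarrow> ('q, 'p) connection \<Rightarrow> bool" where
  "pullback_connection M N i Db D \<longleftrightarrow> connection_along M N i D \<and>
     (\<forall>p\<in>points M. \<forall>x\<in>tangent_space M p. \<forall>Y. vector_field_near N (i p) Y \<longrightarrow>
        D p x (Y \<circ> i) = Db (i p) (pushforward N i p x) Y)"


section \<open>Lightlike submanifolds\<close>

text \<open>All bundles over \<open>M\<close> are subbundles of \<open>i\<^sup>*TN\<close>; in particular \<open>tangent_image\<close> is \<open>T\<^sub>pM\<close> as a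
  subspace of the ambient tangent space.\<close>

definition tangent_image ::
  "('q, 'f::euclidean_space) manifold \<Rightarrow> ('p, 'e::euclidean_space) manifold \<Rightarrow> ('q \<Rightarrow> 'p) \<Rightarrow>
   'q \<Rightarrow> 'p tvec set" where
  "tangent_image M N i p = pushforward N i p ` tangent_space M p"

definition induced_metric ::
  "('p, 'e::euclidean_space) manifold \<Rightarrow> ('q \<Rightarrow> 'p) \<Rightarrow> 'p metric_tensor \<Rightarrow> 'q metric_tensor" where
  "induced_metric N i b p x y = b (i p) (pushforward N i p x) (pushforward N i p y)"

definition normal_space ::
  "('q, 'f::euclidean_space) manifold \<Rightarrow> ('p, 'e::euclidean_space) manifold \<Rightarrow> ('q \<Rightarrow> 'p) \<Rightarrow>
   'p metric_tensor \<Rightarrow> 'q \<Rightarrow> 'p tvec set" where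
  "normal_space M N i b p = perp_in (tangent_space N (i p)) (b (i p)) (tangent_image M N i p)"

definition radical ::
  "('q, 'f::euclidean_space) manifold \<Rightarrow> ('p, 'e::euclidean_space) manifold \<Rightarrow> ('q \<Rightarrow> 'p) \<Rightarrow>
   'p metric_tensor \<Rightarrow> 'q \<Rightarrow> 'p tvec set" where
  "radical M N i b p = tangent_image M N i p \<inter> normal_space M N i b p"

definition lightlike_submanifold ::
  "('q, 'f::euclidean_space) manifold \<Rightarrow> ('p, 'e::euclidean_space) manifold \<Rightarrow> ('q \<Rightarrow> 'p) \<Rightarrow>
   'p metric_tensor \<Rightarrow> nat \<Rightarrow> bool" where
  "lightlike_submanifold M N i b r \<longleftrightarrow>
     immersed_submanifold M N i \<and> 0 < r \<and> smooth_subbundle M N i r (radical M N i b)"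

definition screen_distribution ::
  "('q, 'f::euclidean_space) manifold \<Rightarrow> ('p, 'e::euclidean_space) manifold \<Rightarrow> ('q \<Rightarrow> 'p) \<Rightarrow>
   'p metric_tensor \<Rightarrow> ('q \<Rightarrow> 'p tvec set) \<Rightarrow> bool" where
  "screen_distribution M N i b S \<longleftrightarrow> (\<exists>k. smooth_subbundle M N i k S) \<and>
     (\<forall>p\<in>points M. direct_sum (tangent_image M N i p) (radical M N i b p) (S p) \<and>
        nondegenerate_on (S p) (b (i p)))"

definition screen_transversal_bundle ::
  "('q, 'f::euclidean_space) manifold \<Rightarrow> ('p, 'e::euclidean_space) manifold \<Rightarrow> ('q \<Rightarrow> 'p) \<Rightarrow>
   'p metric_tensor \<Rightarrow> ('q \<Rightarrow> 'p tvec set) \<Rightarrow> bool" where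
  "screen_transversal_bundle M N i b St \<longleftrightarrow> (\<exists>k. smooth_subbundle M N i k St) \<and>
     (\<forall>p\<in>points M. direct_sum (normal_space M N i b p) (radical M N i b p) (St p) \<and>
        nondegenerate_on (St p) (b (i p)))"

text \<open>A local frame \<open>\<xi>\<close> of the radical over \<open>W\<close>, given by vector fields of \<open>M\<close>, and the corresponding
  null transversal sections \<open>n\<close>.\<close>

definition lightlike_frame ::
  "('q, 'f::euclidean_space) manifold \<Rightarrow> ('p, 'e::euclidean_space) manifold \<Rightarrow> ('q \<Rightarrow> 'p) \<Rightarrow>
   'p metric_tensor \<Rightarrow> nat \<Rightarrow> ('q \<Rightarrow> 'p tvec set) \<Rightarrow> ('q \<Rightarrow> 'p tvec set) \<Rightarrow> 'q set \<Rightarrow>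
   (nat \<Rightarrow> 'q \<Rightarrow> 'q tvec) \<Rightarrow> (nat \<Rightarrow> 'q \<Rightarrow> 'p tvec) \<Rightarrow> bool" where
  "lightlike_frame M N i b r S St W \<xi> n \<longleftrightarrow> openin (mtop M) W \<and>
     (\<forall>j\<in>{1..r}. vector_field_on M W (\<xi> j) \<and> section_on M N i W (n j)) \<and>
     (\<forall>p\<in>W. basis_family r (\<lambda>j. pushforward N i p (\<xi> j p)) (radical M N i b p) \<and>
        (\<forall>j\<in>{1..r}. n j p \<in>
           perp_in (perp_in (tangent_space N (i p)) (b (i p)) (S p)) (b (i p)) (St p)) \<and>
        (\<forall>j\<in>{1..r}. \<forall>k\<in>{1..r}.
           b (i p) (pushforward N i p (\<xi> j p)) (n k p) = (if j = k then 1 else 0) \<and>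
           b (i p) (n j p) (n k p) = 0))"

text \<open>\<open>ltr(TM)\<close> is locally spanned by null sections as above.  For \<open>r \<ge> 2\<close> it is not determined by the
  screens: replacing \<open>n\<^sub>j\<close> by \<open>n\<^sub>j + \<Sum>\<^sub>k a\<^sub>j\<^sub>k \<xi>\<^sub>k\<close> with skew-symmetric \<open>a\<close> gives another choice.\<close>

definition lightlike_transversal_bundle ::
  "('q, 'f::euclidean_space) manifold \<Rightarrow> ('p, 'e::euclidean_space) manifold \<Rightarrow> ('q \<Rightarrow> 'p) \<Rightarrow>
   'p metric_tensor \<Rightarrow> nat \<Rightarrow> ('q \<Rightarrow> 'p tvec set) \<Rightarrow> ('q \<Rightarrow> 'p tvec set) \<Rightarrow>
   ('q \<Rightarrow> 'p tvec set) \<Rightarrow> bool" where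
  "lightlike_transversal_bundle M N i b r S St L \<longleftrightarrow>
     (\<forall>u\<in>points M. \<exists>W \<xi> n. u \<in> W \<and> lightlike_frame M N i b r S St W \<xi> n \<and>
        (\<forall>p\<in>W. L p = span ((\<lambda>j. n j p) ` {1..r})))"

definition transversal_space :: "('q \<Rightarrow> 'p tvec set) \<Rightarrow> ('q \<Rightarrow> 'p tvec set) \<Rightarrow> 'q \<Rightarrow> 'p tvec set" where
  "transversal_space L St p = {v + w |v w. v \<in> L p \<and> w \<in> St p}"

text \<open>The Gauss formula, which determines the induced connection \<open>D\<close> and the second fundamental form
  \<open>h\<close>; here \<open>Dp\<close> is the ambient connection for vector fields along \<open>M\<close>.\<close>

definition induced_connection ::
  "('q, 'f::euclidean_space) manifold \<Rightarrow> ('p, 'e::euclidean_space) manifold \<Rightarrow> ('q \<Rightarrow> 'p) \<Rightarrow>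
   ('q, 'p) connection \<Rightarrow> ('q \<Rightarrow> 'p tvec set) \<Rightarrow>
   ('q, 'q) connection \<Rightarrow> ('q \<Rightarrow> 'q tvec \<Rightarrow> ('q \<Rightarrow> 'q tvec) \<Rightarrow> 'p tvec) \<Rightarrow> bool" where
  "induced_connection M N i Dp tr D h \<longleftrightarrow>
     (\<forall>W X Y. vector_field_on M W X \<longrightarrow> vector_field_on M W Y \<longrightarrow>
        vector_field_on M W (\<lambda>p. D p (X p) Y) \<and>
        section_on M N i W (\<lambda>p. h p (X p) Y) \<and>
        (\<forall>p\<in>W. h p (X p) Y \<in> tr p \<and>
           Dp p (X p) (\<lambda>q. pushforward N i q (Y q)) =
             pushforward N i p (D p (X p) Y) + h p (X p) Y))"


section \<open>Curvature and the pseudo-Jacobi operator\<close>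

definition curvature_field ::
  "('q, 'f::euclidean_space) manifold \<Rightarrow> ('q, 'q) connection \<Rightarrow>
   ('q \<Rightarrow> 'q tvec) \<Rightarrow> ('q \<Rightarrow> 'q tvec) \<Rightarrow> ('q \<Rightarrow> 'q tvec) \<Rightarrow> 'q \<Rightarrow> 'q tvec" where
  "curvature_field M D X Y Z p =
     D p (X p) (\<lambda>q. D q (Y q) Z) - D p (Y p) (\<lambda>q. D q (X q) Z) - D p (lie_bracket M X Y p) Z"

text \<open>\<open>R(x, y)z\<close> for tangent vectors at \<open>p\<close>: the common value for all extensions to vector fields.\<close>

definition curvature ::
  "('q, 'f::euclidean_space) manifold \<Rightarrow> ('q, 'q) connection \<Rightarrow>
   'q \<Rightarrow> 'q tvec \<Rightarrow> 'q tvec \<Rightarrow> 'q tvec \<Rightarrow> 'q tvec" where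
  "curvature M D p x y z = (THE w. \<forall>X Y Z.
     vector_field_near M p X \<and> vector_field_near M p Y \<and> vector_field_near M p Z \<and>
     X p = x \<and> Y p = y \<and> Z p = z \<longrightarrow> curvature_field M D X Y Z p = w)"

definition curvature4 ::
  "('q, 'f::euclidean_space) manifold \<Rightarrow> 'q metric_tensor \<Rightarrow> ('q, 'q) connection \<Rightarrow>
   'q \<Rightarrow> 'q tvec \<Rightarrow> 'q tvec \<Rightarrow> 'q tvec \<Rightarrow> 'q tvec \<Rightarrow> real" where
  "curvature4 M g D p x y z w = g p (curvature M D p x y z) w"

definition algebraic_curvature ::
  "('q, 'f::euclidean_space) manifold \<Rightarrow> 'q metric_tensor \<Rightarrow> ('q, 'q) connection \<Rightarrow> bool" where
  "algebraic_curvature M g D \<longleftrightarrow>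
     (\<forall>p\<in>points M. \<forall>x\<in>tangent_space M p. \<forall>y\<in>tangent_space M p.
        \<forall>z\<in>tangent_space M p. \<forall>w\<in>tangent_space M p.
        let R = curvature4 M g D p in
          R x y z w = - R y x z w \<and> R x y z w = R z w x y \<and>
          R x y z w + R y z x w + R z x y w = 0)"

definition ricci ::
  "('q, 'f::euclidean_space) manifold \<Rightarrow> ('q, 'q) connection \<Rightarrow> 'q \<Rightarrow> 'q tvec \<Rightarrow> 'q tvec \<Rightarrow> real" where
  "ricci M D p x y = trace_on (tangent_space M p) (\<lambda>z. curvature M D p x z y)"

definition eta ::
  "('p, 'e::euclidean_space) manifold \<Rightarrow> ('q \<Rightarrow> 'p) \<Rightarrow> 'p metric_tensor \<Rightarrow>
   (nat \<Rightarrow> 'q \<Rightarrow> 'p tvec) \<Rightarrow> nat \<Rightarrow> 'q \<Rightarrow> 'q tvec \<Rightarrow> real" where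
  "eta N i b n j p x = b (i p) (pushforward N i p x) (n j p)"

definition associated_metric ::
  "('p, 'e::euclidean_space) manifold \<Rightarrow> ('q \<Rightarrow> 'p) \<Rightarrow> 'p metric_tensor \<Rightarrow> nat \<Rightarrow>
   (nat \<Rightarrow> 'q \<Rightarrow> 'p tvec) \<Rightarrow> 'q metric_tensor" where
  "associated_metric N i b r n p x y =
     induced_metric N i b p x y + (\<Sum>j=1..r. eta N i b n j p x * eta N i b n j p y)"

definition unit_vectors ::
  "('q, 'f::euclidean_space) manifold \<Rightarrow> 'q metric_tensor \<Rightarrow> real \<Rightarrow> 'q \<Rightarrow> 'q tvec set" where
  "unit_vectors M g s p = {x\<in>tangent_space M p. g p x x = s}"

text \<open>The operator is determined on \<open>T\<^sub>pM\<close> by its defining formula because \<open>gt\<close> is nondegenerate; linearity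
  and self-adjointness follow from the formula for algebraic curvature.\<close>

definition pseudo_jacobi ::
  "('q, 'f::euclidean_space) manifold \<Rightarrow> 'q metric_tensor \<Rightarrow> 'q metric_tensor \<Rightarrow>
   ('q, 'q) connection \<Rightarrow> 'q \<Rightarrow> 'q tvec \<Rightarrow> 'q tvec \<Rightarrow> 'q tvec" where
  "pseudo_jacobi M g gt D p x y = (THE v. v \<in> tangent_space M p \<and>
     (\<forall>w\<in>tangent_space M p. gt p v w = curvature4 M g D p y x x w))"

end

theory Submission
  imports Defs
begin

text \<open>Write \<open>F y = R(x, y)x\<close> for \<open>y \<in> T\<^sub>uM\<close>, and let \<open>\<xi>\<^sub>j\<close>, \<open>\<eta>\<^sub>j\<close> stand for their values at \<open>u\<close>.  The vectors
  \<open>\<xi>\<^sub>j\<close> span the radical of the degenerate metric \<open>g\<close> and \<open>\<eta>\<^sub>j(\<xi>\<^sub>k) = \<delta>\<^sub>j\<^sub>k\<close>, so the metric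
  \<open>gt = g + \<Sum>\<^sub>j \<eta>\<^sub>j \<otimes> \<eta>\<^sub>j\<close> is nondegenerate and satisfies \<open>gt(\<xi>\<^sub>j, w) = \<eta>\<^sub>j(w)\<close>.  The pseudo-Jacobi
  operator is given by \<open>gt(J y, w) = R(y, x, x, w) = - g(F y, w)\<close>, that is by
  \<open>gt(J y, w) = \<Sum>\<^sub>j \<eta>\<^sub>j(F y) \<eta>\<^sub>j(w) - gt(F y, w)\<close>.  Hence \<open>J y = \<Sum>\<^sub>j \<eta>\<^sub>j(F y) \<xi>\<^sub>j - F y\<close>.  The trace of
  \<open>F\<close> is \<open>Ric(x, x)\<close>, and the trace of the rank-one operator \<open>y \<mapsto> \<eta>\<^sub>j(F y) \<xi>\<^sub>j\<close> is \<open>\<eta>\<^sub>j(F \<xi>\<^sub>j)\<close>; this is the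
  formula.  The lemma \<open>trace_degenerate_jacobi\<close> is this computation.

  It presupposes that \<open>y \<mapsto> R(x, y)x\<close> is a linear map of \<open>T\<^sub>uM\<close> into itself.  Since \<open>R(x, y)z\<close> is the
  common value of the curvature expression over all extensions of \<open>x, y, z\<close> to vector fields, this
  is the tensoriality of the curvature, and most of the development establishes it from the charts.
  A map on vector fields that is local, additive and homogeneous over smooth functions depends
  only on the value of the field at the point (\<open>tensorial\<close>), because near the point every field is a
  combination of coordinate fields with smooth coefficients.  For a connection on \<open>TM\<close> the curvature
  has these properties in each argument.  The Leibniz terms cancel because \<open>[X, Y]\<close> acts as
  \<open>XY - YX\<close>, and \<open>[X, Y]\<close> is a tangent vector because second derivatives commute
  (\<open>frechet_derivative_commute\<close>, \<open>lie_bracket_tangent\<close>).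

  Finally, the induced connection is a connection on \<open>TM\<close> (\<open>induced_connection_is_connection\<close>).  The
  Gauss formula describes it as the tangential part of the ambient derivative, and this part is
  well defined since \<open>TM\<close> and the transversal bundle meet in zero (\<open>transversal_space_complement\<close>).
  The connection laws of the ambient derivative then pass to its tangential part.\<close>

section \<open>Calculus of smooth functions\<close>

lemma Ck_on_subset: "Ck_on k S f \<Longrightarrow> T \<subseteq> S \<Longrightarrow> Ck_on k T f"
proof (induction k arbitrary: f)
  case 0
  then show ?case by (auto intro: continuous_on_subset)
next
  case (Suc k)
  then show ?case by (auto intro: differentiable_on_subset)
qed

lemma Ck_on_SucD: "Ck_on (Suc k) S f \<Longrightarrow> Ck_on k S f"
proof (induction k arbitrary: f)
  case 0
  then show ?case by (auto intro: differentiable_imp_continuous_on)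
next
  case (Suc k)
  then show ?case by (metis Ck_on.simps(2))
qed

lemma Ck_on_cong:
  assumes "open S" "\<And>x. x \<in> S \<Longrightarrow> f x = g x"
  shows "Ck_on k S f \<longleftrightarrow> Ck_on k S g"
  using assms(2)
proof (induction k arbitrary: f g)
  case 0
  then show ?case using continuous_on_cong[of S S f g] by simp
next
  case (Suc k)
  have h: "(f has_derivative F) (at x) \<longleftrightarrow> (g has_derivative F) (at x)" if "x \<in> S" for x F
    using Suc.prems that assms(1) has_derivative_transform_within_open[of f F x UNIV S g]
      has_derivative_transform_within_open[of g F x UNIV S f] by auto
  then have D: "frechet_derivative f (at x) = frechet_derivative g (at x)" if "x \<in> S" for x
    unfolding frechet_derivative_def using that by simp
  have "f differentiable_on S \<longleftrightarrow> g differentiable_on S"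
    using h assms(1) unfolding differentiable_on_eq_differentiable_at[OF assms(1)] differentiable_def
    by simp
  moreover have "Ck_on k S (\<lambda>x. frechet_derivative f (at x) v)
      \<longleftrightarrow> Ck_on k S (\<lambda>x. frechet_derivative g (at x) v)" for v
    using D by (intro Suc.IH) simp
  ultimately show ?case by simp
qed

text \<open>Smoothness is a local property; charts provide it only on small open sets.\<close>

lemma Ck_on_open_UnionI:
  assumes "\<And>x. x \<in> S \<Longrightarrow> \<exists>T. open T \<and> x \<in> T \<and> Ck_on k T f"
  shows "Ck_on k S f"
  using assms
proof (induction k arbitrary: f)
  case 0
  then show ?case
    by (fastforce intro!: continuous_at_imp_continuous_on simp: continuous_on_eq_continuous_at)
next
  case (Suc k)
  have "f differentiable_on S"
    unfolding differentiable_on_def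
  proof
    fix x assume "x \<in> S"
    then obtain T where "open T" "x \<in> T" "f differentiable_on T"
      using Suc.prems by auto
    then show "f differentiable at x within S"
      using differentiable_on_eq_differentiable_at differentiable_at_withinI by blast
  qed
  moreover have "Ck_on k S (\<lambda>x. frechet_derivative f (at x) v)" for v
    using Suc.prems by (intro Suc.IH) fastforce
  ultimately show ?case by simp
qed

lemma Ck_on_const: "Ck_on k S (\<lambda>x. c)"
  by (induction k arbitrary: c) auto

lemma Ck_on_add:
  assumes "open S" "Ck_on k S f" "Ck_on k S g"
  shows "Ck_on k S (\<lambda>x. f x + g x)"
  using assms(2,3)
proof (induction k arbitrary: f g)
  case 0
  then show ?case by (simp add: continuous_on_add continuous_on_scaleR)
next
  case (Suc k)
  have d: "f differentiable (at x)" "g differentiable (at x)" if "x \<in> S" for x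
    using Suc.prems assms(1) that by (auto simp: differentiable_on_eq_differentiable_at)
  have "frechet_derivative (\<lambda>x. f x + g x) (at x) v
      = frechet_derivative f (at x) v + frechet_derivative g (at x) v" if "x \<in> S" for x v
    using frechet_derivative_at[OF has_derivative_add[OF d[OF that, unfolded frechet_derivative_works]]]
    by metis
  then have "Ck_on k S (\<lambda>x. frechet_derivative (\<lambda>x. f x + g x) (at x) v)" for v
    using Suc Ck_on_cong[OF assms(1)] by (simp cong: Ck_on_cong[OF assms(1)])
  then show ?case using Suc.prems by simp
qed

lemma Ck_on_bounded_linear:
  assumes "open S" "bounded_linear L" "Ck_on k S f"
  shows "Ck_on k S (\<lambda>x. L (f x))"
  using assms(3)
proof (induction k arbitrary: f)
  case 0
  then show ?case using assms(2) by (auto intro: bounded_linear.continuous_on)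
next
  case (Suc k)
  have d: "f differentiable (at x)" if "x \<in> S" for x
    using Suc.prems assms(1) that by (auto simp: differentiable_on_eq_differentiable_at)
  have h: "((\<lambda>x. L (f x)) has_derivative (\<lambda>v. L (frechet_derivative f (at x) v))) (at x)"
    if "x \<in> S" for x
    using bounded_linear.has_derivative[OF assms(2)] d[OF that] frechet_derivative_works by blast
  have "frechet_derivative (\<lambda>x. L (f x)) (at x) v = L (frechet_derivative f (at x) v)"
    if "x \<in> S" for x v
    using frechet_derivative_at[OF h[OF that]] by metis
  then have "Ck_on k S (\<lambda>x. frechet_derivative (\<lambda>x. L (f x)) (at x) v)" for v
    using Suc by (simp cong: Ck_on_cong[OF assms(1)])
  moreover have "(\<lambda>x. L (f x)) differentiable_on S"
    using h unfolding differentiable_on_eq_differentiable_at[OF assms(1)] differentiable_def by blast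
  ultimately show ?case by simp
qed

lemma Ck_on_scaleR:
  fixes f :: "'a::real_normed_vector \<Rightarrow> real"
  assumes "open S" "Ck_on k S f" "Ck_on k S g"
  shows "Ck_on k S (\<lambda>x. f x *\<^sub>R g x)"
  using assms(2,3)
proof (induction k arbitrary: f g)
  case 0
  then show ?case by (simp add: continuous_on_add continuous_on_scaleR)
next
  case (Suc k)
  have d: "f differentiable (at x)" "g differentiable (at x)" if "x \<in> S" for x
    using Suc.prems assms(1) that by (auto simp: differentiable_on_eq_differentiable_at)
  have h: "((\<lambda>x. f x *\<^sub>R g x) has_derivative
      (\<lambda>v. f x *\<^sub>R frechet_derivative g (at x) v + frechet_derivative f (at x) v *\<^sub>R g x)) (at x)"
    if "x \<in> S" for x
    using has_derivative_scaleR[OF d[OF that, unfolded frechet_derivative_works]] .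
  have "frechet_derivative (\<lambda>x. f x *\<^sub>R g x) (at x) v
      = f x *\<^sub>R frechet_derivative g (at x) v + frechet_derivative f (at x) v *\<^sub>R g x"
    if "x \<in> S" for x v
    using frechet_derivative_at[OF h[OF that]] by metis
  then have "Ck_on k S (\<lambda>x. frechet_derivative (\<lambda>x. f x *\<^sub>R g x) (at x) v)" for v
    using Suc Suc.prems[THEN Ck_on_SucD]
    by (simp add: Ck_on_add[OF assms(1)] cong: Ck_on_cong[OF assms(1)])
  moreover have "(\<lambda>x. f x *\<^sub>R g x) differentiable_on S"
    using h unfolding differentiable_on_eq_differentiable_at[OF assms(1)] differentiable_def by blast
  ultimately show ?case by simp
qed

lemma Ck_on_sum:
  assumes "open S" "\<And>a. a \<in> A \<Longrightarrow> Ck_on k S (f a)"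
  shows "Ck_on k S (\<lambda>x. \<Sum>a\<in>A. f a x)"
  using assms(2)
  by (induction A rule: infinite_finite_induct) (auto intro: Ck_on_const Ck_on_add[OF assms(1)])

lemma frechet_derivative_eq_sum_Basis:
  fixes f :: "'a::euclidean_space \<Rightarrow> 'b::real_normed_vector"
  assumes "f differentiable (at x)"
  shows "frechet_derivative f (at x) v = (\<Sum>b\<in>Basis. (v \<bullet> b) *\<^sub>R frechet_derivative f (at x) b)"
proof -
  interpret linear "frechet_derivative f (at x)"
    using assms by (rule linear_frechet_derivative)
  show ?thesis
    by (subst euclidean_representation[symmetric, of v]) (simp only: sum scaleR)
qed

text \<open>By the chain rule and an expansion in the standard basis of the intermediate space, each
  directional derivative of the composition is a sum of products of \<open>C\<^sup>k\<close> functions; the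
  induction hypothesis applies to the factors \<open>frechet_derivative f (at (g x)) b\<close>, for which \<open>b\<close> no longer depends on \<open>x\<close>.\<close>

lemma Ck_on_compose:
  fixes f :: "'b::euclidean_space \<Rightarrow> 'c::real_normed_vector"
  assumes "open S" "open T" "g ` S \<subseteq> T" "Ck_on k T f" "Ck_on k S g"
  shows "Ck_on k S (\<lambda>x. f (g x))"
  using assms(4,5)
proof (induction k arbitrary: f)
  case 0
  then show ?case using assms(3) by (auto intro: continuous_on_compose2)
next
  case (Suc k)
  have d: "f differentiable (at (g x))" "g differentiable (at x)" if "x \<in> S" for x
    using Suc.prems assms(1,2,3) that by (auto simp: differentiable_on_eq_differentiable_at)
  have c: "frechet_derivative (\<lambda>x. f (g x)) (at x) v
      = (\<Sum>b\<in>Basis. (frechet_derivative g (at x) v \<bullet> b) *\<^sub>R frechet_derivative f (at (g x)) b)"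
    if "x \<in> S" for x v
  proof -
    have "frechet_derivative (\<lambda>x. f (g x)) (at x)
        = frechet_derivative f (at (g x)) \<circ> frechet_derivative g (at x)"
      using frechet_derivative_compose[of g x f] d[OF that] by (simp add: o_def)
    then show ?thesis
      using frechet_derivative_eq_sum_Basis[OF d(1)[OF that], of "frechet_derivative g (at x) v"]
      by (simp only: o_apply)
  qed
  have "Ck_on k S (\<lambda>x. (frechet_derivative g (at x) v \<bullet> b) *\<^sub>R frechet_derivative f (at (g x)) b)"
    for v b
    using Suc Suc.prems[THEN Ck_on_SucD] assms(1)
    by (intro Ck_on_scaleR Ck_on_bounded_linear[OF _ bounded_linear_inner_left]) auto
  then have "Ck_on k S (\<lambda>x. frechet_derivative (\<lambda>x. f (g x)) (at x) v)" for v
    by (simp add: c Ck_on_sum assms(1) cong: Ck_on_cong[OF assms(1)])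
  moreover have "(\<lambda>x. f (g x)) differentiable_on S"
    using d differentiable_chain_at[of g _ f]
    unfolding differentiable_on_eq_differentiable_at[OF assms(1)] o_def by blast
  ultimately show ?case by simp
qed

lemma smooth_on_subset: "smooth_on S f \<Longrightarrow> T \<subseteq> S \<Longrightarrow> smooth_on T f"
  unfolding smooth_on_def using Ck_on_subset by blast

lemma smooth_on_cong: "open S \<Longrightarrow> (\<And>x. x \<in> S \<Longrightarrow> f x = g x) \<Longrightarrow> smooth_on S f \<longleftrightarrow> smooth_on S g"
  unfolding smooth_on_def using Ck_on_cong by metis

lemma smooth_on_open_UnionI:
  "(\<And>x. x \<in> S \<Longrightarrow> \<exists>T. open T \<and> x \<in> T \<and> smooth_on T f) \<Longrightarrow> smooth_on S f"
  unfolding smooth_on_def using Ck_on_open_UnionI by metis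

lemma smooth_on_const: "smooth_on S (\<lambda>x. c)"
  unfolding smooth_on_def using Ck_on_const by blast

lemma smooth_on_add: "open S \<Longrightarrow> smooth_on S f \<Longrightarrow> smooth_on S g \<Longrightarrow> smooth_on S (\<lambda>x. f x + g x)"
  unfolding smooth_on_def using Ck_on_add by blast

lemma smooth_on_mult:
  fixes f g :: "'a::real_normed_vector \<Rightarrow> real"
  shows "open S \<Longrightarrow> smooth_on S f \<Longrightarrow> smooth_on S g \<Longrightarrow> smooth_on S (\<lambda>x. f x * g x)"
  unfolding smooth_on_def using Ck_on_scaleR[of S _ f g] by simp

lemma smooth_on_inner_left: "open S \<Longrightarrow> smooth_on S f \<Longrightarrow> smooth_on S (\<lambda>x. f x \<bullet> b)"
  unfolding smooth_on_def using Ck_on_bounded_linear[OF _ bounded_linear_inner_left] by blast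

lemma smooth_on_compose:
  fixes f :: "'b::euclidean_space \<Rightarrow> 'c::real_normed_vector"
  shows "open S \<Longrightarrow> open T \<Longrightarrow> g ` S \<subseteq> T \<Longrightarrow> smooth_on T f \<Longrightarrow> smooth_on S g
    \<Longrightarrow> smooth_on S (\<lambda>x. f (g x))"
  unfolding smooth_on_def using Ck_on_compose by blast

lemma smooth_on_frechet_derivative:
  "smooth_on S f \<Longrightarrow> smooth_on S (\<lambda>x. frechet_derivative f (at x) v)"
  unfolding smooth_on_def by (metis Ck_on.simps(2))

lemma smooth_on_imp_differentiable_at:
  "smooth_on S f \<Longrightarrow> open S \<Longrightarrow> x \<in> S \<Longrightarrow> f differentiable (at x)"
  unfolding smooth_on_def by (metis Ck_on.simps(2) differentiable_on_eq_differentiable_at)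

lemma smooth_on_imp_continuous_on: "smooth_on S f \<Longrightarrow> continuous_on S f"
  unfolding smooth_on_def by (metis Ck_on.simps(1))

text \<open>The second difference of \<open>F\<close> over a parallelogram is the increment in \<open>s\<close> of
  \<open>F(x + sv + hw) - F(x + sv)\<close>.  The mean value theorem in \<open>s\<close>, followed by the mean value theorem in
  \<open>t\<close>, turns it into a mixed second derivative at an intermediate point.\<close>

lemma second_difference_mvt:
  fixes F :: "'a::real_normed_vector \<Rightarrow> real"
  assumes F: "smooth_on T F" and T: "open T" and h: "h > 0"
    and in_T: "\<And>s t. 0 \<le> s \<Longrightarrow> s \<le> h \<Longrightarrow> 0 \<le> t \<Longrightarrow> t \<le> h \<Longrightarrow> x + s *\<^sub>R v + t *\<^sub>R w \<in> T"
  obtains s t where "0 < s" "s < h" "0 < t" "t < h"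
    "F (x + h *\<^sub>R v + h *\<^sub>R w) - F (x + h *\<^sub>R v) - F (x + h *\<^sub>R w) + F x
      = h * h * frechet_derivative (\<lambda>y. frechet_derivative F (at y) v) (at (x + s *\<^sub>R v + t *\<^sub>R w)) w"
proof -
  define G where "G = (\<lambda>y. frechet_derivative F (at y) v)"
  have G: "smooth_on T G"
    unfolding G_def by (rule smooth_on_frechet_derivative[OF F])
  have dF: "((\<lambda>s. F (x + s *\<^sub>R v + t *\<^sub>R w)) has_real_derivative G (x + s *\<^sub>R v + t *\<^sub>R w)) (at s)"
    if "0 \<le> s" "s \<le> h" "0 \<le> t" "t \<le> h" for s t
  proof -
    let ?y = "x + s *\<^sub>R v + t *\<^sub>R w"
    have D: "F differentiable (at ?y)"
      using smooth_on_imp_differentiable_at[OF F T in_T[OF that]] .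
    have "((\<lambda>s. F (x + s *\<^sub>R v + t *\<^sub>R w)) has_derivative
        (\<lambda>s. frechet_derivative F (at ?y) (s *\<^sub>R v))) (at s)"
      by (rule has_derivative_compose[of "\<lambda>s. x + s *\<^sub>R v + t *\<^sub>R w"])
        (auto intro!: derivative_eq_intros D[unfolded frechet_derivative_works])
    moreover have "frechet_derivative F (at ?y) (s *\<^sub>R v) = G ?y * s" for s
      using linear_frechet_derivative[OF D] by (simp add: G_def linear_cmul)
    ultimately show ?thesis
      by (simp add: has_field_derivative_def)
  qed
  have dG: "((\<lambda>t. G (x + s *\<^sub>R v + t *\<^sub>R w)) has_real_derivative
      frechet_derivative G (at (x + s *\<^sub>R v + t *\<^sub>R w)) w) (at t)"
    if "0 \<le> s" "s \<le> h" "0 \<le> t" "t \<le> h" for s t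
  proof -
    let ?y = "x + s *\<^sub>R v + t *\<^sub>R w"
    have D: "G differentiable (at ?y)"
      using smooth_on_imp_differentiable_at[OF G T in_T[OF that]] .
    have "((\<lambda>t. G (x + s *\<^sub>R v + t *\<^sub>R w)) has_derivative
        (\<lambda>t. frechet_derivative G (at ?y) (t *\<^sub>R w))) (at t)"
      by (rule has_derivative_compose[of "\<lambda>t. x + s *\<^sub>R v + t *\<^sub>R w"])
        (auto intro!: derivative_eq_intros D[unfolded frechet_derivative_works])
    moreover have "frechet_derivative G (at ?y) (t *\<^sub>R w) = frechet_derivative G (at ?y) w * t" for t
      using linear_frechet_derivative[OF D] by (simp add: linear_cmul)
    ultimately show ?thesis
      by (simp add: has_field_derivative_def)
  qed
  define \<phi> where "\<phi> = (\<lambda>s. F (x + s *\<^sub>R v + h *\<^sub>R w) - F (x + s *\<^sub>R v + 0 *\<^sub>R w))"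
  have "(\<phi> has_real_derivative G (x + s *\<^sub>R v + h *\<^sub>R w) - G (x + s *\<^sub>R v + 0 *\<^sub>R w)) (at s)"
    if "0 \<le> s" "s \<le> h" for s
    unfolding \<phi>_def using that h by (intro DERIV_diff dF) auto
  from MVT2[of 0 h \<phi>, OF h this]
  obtain s where s: "0 < s" "s < h"
    and 1: "\<phi> h - \<phi> 0 = (h - 0) * (G (x + s *\<^sub>R v + h *\<^sub>R w) - G (x + s *\<^sub>R v + 0 *\<^sub>R w))"
    by blast
  obtain t where t: "0 < t" "t < h"
    and 2: "G (x + s *\<^sub>R v + h *\<^sub>R w) - G (x + s *\<^sub>R v + 0 *\<^sub>R w)
      = (h - 0) * frechet_derivative G (at (x + s *\<^sub>R v + t *\<^sub>R w)) w"
    using MVT2[of 0 h "\<lambda>t. G (x + s *\<^sub>R v + t *\<^sub>R w)", OF h dG[of s]] s by auto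
  show ?thesis
    using that[OF s t] 1 2 by (simp add: \<phi>_def G_def algebra_simps)
qed

text \<open>The second difference is symmetric in \<open>v\<close> and \<open>w\<close>, so in every small parallelogram the two
  mixed derivatives take a common value, possibly at different points.  Continuity gives equality
  at the corner.\<close>

lemma frechet_derivative_commute:
  fixes F :: "'a::real_normed_vector \<Rightarrow> real"
  assumes F: "smooth_on T F" and T: "open T" and x: "x \<in> T"
  shows "frechet_derivative (\<lambda>y. frechet_derivative F (at y) v) (at x) w
    = frechet_derivative (\<lambda>y. frechet_derivative F (at y) w) (at x) v"
proof -
  define A where "A = (\<lambda>y. frechet_derivative (\<lambda>y. frechet_derivative F (at y) v) (at y) w)"
  define B where "B = (\<lambda>y. frechet_derivative (\<lambda>y. frechet_derivative F (at y) w) (at y) v)"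
  have "continuous_on T A" "continuous_on T B"
    unfolding A_def B_def
    by (intro smooth_on_imp_continuous_on smooth_on_frechet_derivative F)+
  then have cont: "isCont A x" "isCont B x"
    using T x continuous_on_eq_continuous_at by blast+
  have "\<bar>A x - B x\<bar> < e" if "e > 0" for e
  proof -
    obtain d1 where d1: "d1 > 0" "\<And>y. dist y x < d1 \<Longrightarrow> dist (A y) (A x) < e/2"
      using cont(1) \<open>e > 0\<close> unfolding continuous_at_eps_delta by (meson half_gt_zero)
    obtain d2 where d2: "d2 > 0" "\<And>y. dist y x < d2 \<Longrightarrow> dist (B y) (B x) < e/2"
      using cont(2) \<open>e > 0\<close> unfolding continuous_at_eps_delta by (meson half_gt_zero)
    obtain d3 where d3: "d3 > 0" "ball x d3 \<subseteq> T"
      using T x open_contains_ball by blast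
    define d where "d = min d1 (min d2 d3)"
    \<comment> \<open>the parallelogram with sides \<open>h v\<close> and \<open>h w\<close> lies in the ball of radius \<open>d\<close>; adding 1 covers \<open>v = w = 0\<close>\<close>
    define h where "h = d / (2 * (norm v + norm w + 1))"
    have d: "d > 0" using d1 d2 d3 by (simp add: d_def)
    have h: "h > 0" using d by (simp add: h_def add_nonneg_pos)
    have near: "dist (x + s *\<^sub>R v + t *\<^sub>R w) x < d" if "0 \<le> s" "s \<le> h" "0 \<le> t" "t \<le> h" for s t
    proof -
      have "dist (x + s *\<^sub>R v + t *\<^sub>R w) x = norm (s *\<^sub>R v + t *\<^sub>R w)"
        by (simp add: dist_norm add.assoc)
      also have "\<dots> \<le> s * norm v + t * norm w"
        using norm_triangle_ineq[of "s *\<^sub>R v" "t *\<^sub>R w"] that by simp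
      also have "\<dots> \<le> h * norm v + h * norm w"
        using that by (intro add_mono mult_right_mono) auto
      also have "\<dots> < h * (2 * (norm v + norm w + 1))"
        using h by (simp add: distrib_left add_pos_nonneg add_nonneg_pos)
      also have "\<dots> = d"
        using add_nonneg_pos[of "norm v + norm w" 1] by (simp add: h_def)
      finally show ?thesis .
    qed
    have in_T: "x + s *\<^sub>R v + t *\<^sub>R w \<in> T" if "0 \<le> s" "s \<le> h" "0 \<le> t" "t \<le> h" for s t
      using near[OF that] d3(2) by (auto simp: d_def dist_commute)
    have in_T': "x + s *\<^sub>R w + t *\<^sub>R v \<in> T" if "0 \<le> s" "s \<le> h" "0 \<le> t" "t \<le> h" for s t
      using in_T[of t s] that by (simp add: algebra_simps)
    obtain s t where st: "0 < s" "s < h" "0 < t" "t < h"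
      and 1: "F (x + h *\<^sub>R v + h *\<^sub>R w) - F (x + h *\<^sub>R v) - F (x + h *\<^sub>R w) + F x
        = h * h * A (x + s *\<^sub>R v + t *\<^sub>R w)"
      unfolding A_def by (rule second_difference_mvt[OF F T h in_T])
    obtain s' t' where st': "0 < s'" "s' < h" "0 < t'" "t' < h"
      and 2: "F (x + h *\<^sub>R w + h *\<^sub>R v) - F (x + h *\<^sub>R w) - F (x + h *\<^sub>R v) + F x
        = h * h * B (x + s' *\<^sub>R w + t' *\<^sub>R v)"
      unfolding B_def by (rule second_difference_mvt[OF F T h in_T'])
    have "h * h * A (x + s *\<^sub>R v + t *\<^sub>R w) = h * h * B (x + t' *\<^sub>R v + s' *\<^sub>R w)"
      using 1 2 by (simp add: algebra_simps)
    then have eq: "A (x + s *\<^sub>R v + t *\<^sub>R w) = B (x + t' *\<^sub>R v + s' *\<^sub>R w)"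
      using h by simp
    have "dist (A (x + s *\<^sub>R v + t *\<^sub>R w)) (A x) < e/2"
      using near[of s t] st by (intro d1) (auto simp: d_def)
    moreover have "dist (B (x + t' *\<^sub>R v + s' *\<^sub>R w)) (B x) < e/2"
      using near[of t' s'] st' by (intro d2) (auto simp: d_def)
    ultimately show ?thesis
      unfolding eq dist_real_def by linarith
  qed
  from this[of "\<bar>A x - B x\<bar>"] have "A x = B x"
    by (cases "A x = B x") auto
  then show ?thesis by (simp add: A_def B_def)
qed

section \<open>Smooth functions on a manifold\<close>

lemma chart_facts:
  assumes "smooth_manifold M" "(U, \<phi>) \<in> atlas M"
  shows chart_domain_open: "openin (mtop M) U"
    and chart_image_open: "open (\<phi> ` U)"
    and chart_inj: "inj_on \<phi> U"
    and chart_homeomorphic: "homeomorphic_map (subtopology (mtop M) U) (top_of_set (\<phi> ` U)) \<phi>"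
proof -
  have *: "openin (mtop M) U \<and> open (\<phi> ` U)
      \<and> homeomorphic_map (subtopology (mtop M) U) (top_of_set (\<phi> ` U)) \<phi>"
    using assms unfolding smooth_manifold_def by blast
  then show "openin (mtop M) U" "open (\<phi> ` U)"
    and h: "homeomorphic_map (subtopology (mtop M) U) (top_of_set (\<phi> ` U)) \<phi>"
    by auto
  have "topspace (subtopology (mtop M) U) = U"
    using * openin_subset[of "mtop M" U] by (auto simp: topspace_subtopology)
  then show "inj_on \<phi> U"
    using homeomorphic_imp_injective_map[OF h] by simp
qed

lemma chart_image_Int_open:
  assumes M: "smooth_manifold M" and c: "(U, \<phi>) \<in> atlas M" and W: "openin (mtop M) W"
  shows "open (\<phi> ` (U \<inter> W))"
proof -
  have "openin (subtopology (mtop M) U) (U \<inter> W)"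
    using W by (metis inf_commute openin_subtopology_Int)
  then have "openin (top_of_set (\<phi> ` U)) (\<phi> ` (U \<inter> W))"
    using chart_homeomorphic[OF M c] homeomorphic_imp_open_map open_map_def by blast
  then show ?thesis
    using chart_image_open[OF M c] openin_open_eq by blast
qed

lemma chart_preimage_open:
  assumes M: "smooth_manifold M" and c: "(U, \<phi>) \<in> atlas M" and T: "open T"
  shows "openin (mtop M) {p \<in> U. \<phi> p \<in> T}"
proof -
  have top: "topspace (subtopology (mtop M) U) = U"
    using openin_subset[OF chart_domain_open[OF M c]] by (auto simp: topspace_subtopology)
  have "openin (top_of_set (\<phi> ` U)) (\<phi> ` U \<inter> T)"
    using T by (simp add: openin_open_Int)
  then have "openin (subtopology (mtop M) U) {p \<in> U. \<phi> p \<in> \<phi> ` U \<inter> T}"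
    using openin_continuous_map_preimage[OF
        homeomorphic_imp_continuous_map[OF chart_homeomorphic[OF M c]], of "\<phi> ` U \<inter> T"]
    unfolding top by simp
  moreover have "{p \<in> U. \<phi> p \<in> \<phi> ` U \<inter> T} = {p \<in> U. \<phi> p \<in> T}" by auto
  ultimately show ?thesis
    using openin_trans_full[OF _ chart_domain_open[OF M c]] by simp
qed

lemma chart_inverse:
  assumes "smooth_manifold M" "(U, \<phi>) \<in> atlas M" "p \<in> U"
  shows "inv_into U \<phi> (\<phi> p) = p"
  using chart_inj[OF assms(1,2)] assms(3) by simp

lemma chart_exists:
  assumes "smooth_manifold M" "p \<in> points M"
  obtains U \<phi> where "(U, \<phi>) \<in> atlas M" "p \<in> U"
proof -
  have "points M = (\<Union>(U, \<phi>)\<in>atlas M. U)"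
    using assms(1) unfolding smooth_manifold_def by (elim conjE)
  then show ?thesis using that assms(2) by auto
qed

lemma smooth_on_transition:
  assumes "smooth_manifold M" "(U, \<phi>) \<in> atlas M" "(V, \<psi>) \<in> atlas M"
  shows "smooth_on (\<phi> ` (U \<inter> V)) (\<psi> \<circ> inv_into U \<phi>)"
proof -
  have "\<forall>(U, \<phi>)\<in>atlas M. \<forall>(V, \<psi>)\<in>atlas M. smooth_on (\<phi> ` (U \<inter> V)) (\<psi> \<circ> inv_into U \<phi>)"
    using assms(1) unfolding smooth_manifold_def by (elim conjE)
  from bspec[OF bspec[OF this assms(2), simplified] assms(3)] show ?thesis by simp
qed

lemma smooth_near_in_points: "smooth_near M p f \<Longrightarrow> p \<in> points M"
  unfolding smooth_near_def smooth_fun_def using openin_subset by blast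

lemma smooth_near_chartD:
  assumes M: "smooth_manifold M" and c: "(U, \<phi>) \<in> atlas M" "p \<in> U" and f: "smooth_near M p f"
  obtains T where "open T" "\<phi> p \<in> T" "smooth_on T (f \<circ> inv_into U \<phi>)"
proof -
  obtain W where W: "p \<in> W" "openin (mtop M) W" "smooth_on (\<phi> ` (U \<inter> W)) (f \<circ> inv_into U \<phi>)"
    using f c unfolding smooth_near_def smooth_fun_def by blast
  show ?thesis
    using that[of "\<phi> ` (U \<inter> W)"] W c chart_image_Int_open[OF M c(1) W(2)] by auto
qed

text \<open>A single chart around \<open>p\<close> decides smoothness near \<open>p\<close>: the representation in any other chart is
  the composition with a smooth transition map.\<close>

lemma smooth_near_chartI:
  assumes M: "smooth_manifold M" and c: "(U, \<phi>) \<in> atlas M" "p \<in> U"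
    and T: "open T" "\<phi> p \<in> T" and f: "smooth_on T (f \<circ> inv_into U \<phi>)"
  shows "smooth_near M p f"
proof -
  define W where "W = {q \<in> U. \<phi> q \<in> T}"
  have W: "openin (mtop M) W"
    unfolding W_def by (rule chart_preimage_open[OF M c(1) T(1)])
  have "smooth_on (\<psi> ` (V \<inter> W)) (f \<circ> inv_into V \<psi>)" if c': "(V, \<psi>) \<in> atlas M" for V \<psi>
  proof -
    let ?S = "\<psi> ` (V \<inter> W)"
    have S: "open ?S" by (rule chart_image_Int_open[OF M c' W])
    have "smooth_on ?S (\<phi> \<circ> inv_into V \<psi>)"
      using smooth_on_transition[OF M c' c(1)] by (rule smooth_on_subset) (auto simp: W_def)
    moreover have "(\<phi> \<circ> inv_into V \<psi>) ` ?S \<subseteq> T"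
      using chart_inverse[OF M c'] by (auto simp: W_def)
    ultimately have "smooth_on ?S (\<lambda>y. (f \<circ> inv_into U \<phi>) ((\<phi> \<circ> inv_into V \<psi>) y))"
      using smooth_on_compose[OF S T(1) _ f] by blast
    moreover have "(f \<circ> inv_into U \<phi>) ((\<phi> \<circ> inv_into V \<psi>) y) = (f \<circ> inv_into V \<psi>) y"
      if "y \<in> ?S" for y
      using that chart_inverse[OF M c'] chart_inverse[OF M c(1)] by (auto simp: W_def)
    ultimately show ?thesis
      using smooth_on_cong[OF S, of "\<lambda>y. (f \<circ> inv_into U \<phi>) ((\<phi> \<circ> inv_into V \<psi>) y)"
        "f \<circ> inv_into V \<psi>"] by simp
  qed
  then show ?thesis
    unfolding smooth_near_def smooth_fun_def using W c T by (intro exI[of _ W]) (auto simp: W_def)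
qed

text \<open>Reduces all statements about smooth functions on open sets to pointwise ones, where the chart
  may be chosen freely.\<close>

lemma smooth_fun_iff_near:
  assumes M: "smooth_manifold M"
  shows "smooth_fun M W f \<longleftrightarrow> openin (mtop M) W \<and> (\<forall>p\<in>W. smooth_near M p f)"
proof
  show "smooth_fun M W f \<Longrightarrow> openin (mtop M) W \<and> (\<forall>p\<in>W. smooth_near M p f)"
    unfolding smooth_near_def smooth_fun_def by blast
next
  assume *: "openin (mtop M) W \<and> (\<forall>p\<in>W. smooth_near M p f)"
  have "smooth_on (\<phi> ` (U \<inter> W)) (f \<circ> inv_into U \<phi>)" if c: "(U, \<phi>) \<in> atlas M" for U \<phi>
  proof (rule smooth_on_open_UnionI)
    fix y assume "y \<in> \<phi> ` (U \<inter> W)"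
    then obtain p where p: "p \<in> U" "p \<in> W" "y = \<phi> p" by auto
    then obtain T where "open T" "\<phi> p \<in> T" "smooth_on T (f \<circ> inv_into U \<phi>)"
      using * by (meson smooth_near_chartD[OF M c p(1)])
    then show "\<exists>T. open T \<and> y \<in> T \<and> smooth_on T (f \<circ> inv_into U \<phi>)"
      using p by blast
  qed
  then show "smooth_fun M W f"
    unfolding smooth_fun_def using * by blast
qed

lemma smooth_near_nbhd:
  assumes M: "smooth_manifold M" and f: "smooth_near M p f"
  obtains W where "openin (mtop M) W" "p \<in> W" "\<forall>q\<in>W. smooth_near M q f"
proof -
  obtain W where "p \<in> W" "smooth_fun M W f"
    using f unfolding smooth_near_def by auto
  then show ?thesis using that unfolding smooth_fun_iff_near[OF M] by blast
qed

lemma smooth_near_cong: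
  assumes M: "smooth_manifold M" and W: "openin (mtop M) W" "p \<in> W"
    and eq: "\<And>q. q \<in> W \<Longrightarrow> f q = g q" and f: "smooth_near M p f"
  shows "smooth_near M p g"
proof -
  have "p \<in> points M" using f by (rule smooth_near_in_points)
  then obtain U \<phi> where c: "(U, \<phi>) \<in> atlas M" "p \<in> U"
    by (rule chart_exists[OF M])
  obtain T where T: "open T" "\<phi> p \<in> T" "smooth_on T (f \<circ> inv_into U \<phi>)"
    by (rule smooth_near_chartD[OF M c f])
  let ?T = "T \<inter> \<phi> ` (U \<inter> W)"
  have op: "open ?T" using T chart_image_Int_open[OF M c(1) W(1)] by auto
  have "smooth_on ?T (f \<circ> inv_into U \<phi>)" using T(3) by (rule smooth_on_subset) auto
  moreover have "(f \<circ> inv_into U \<phi>) y = (g \<circ> inv_into U \<phi>) y" if "y \<in> ?T" for y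
    using that eq chart_inverse[OF M c(1)] by auto
  ultimately have "smooth_on ?T (g \<circ> inv_into U \<phi>)"
    using smooth_on_cong[OF op, of "f \<circ> inv_into U \<phi>" "g \<circ> inv_into U \<phi>"] by simp
  then show ?thesis
    using T W c by (intro smooth_near_chartI[OF M c op]) auto
qed

lemma smooth_near_const: 
  assumes M: "smooth_manifold M" and p: "p \<in> points M"
  shows "smooth_near M p (\<lambda>q. c)"
proof -
  obtain U \<phi> where c: "(U, \<phi>) \<in> atlas M" "p \<in> U"
    by (rule chart_exists[OF M p])
  show ?thesis
    by (rule smooth_near_chartI[OF M c, of UNIV]) (auto simp: o_def smooth_on_const)
qed

lemma smooth_near_combine:
  fixes f g :: "'p \<Rightarrow> real" and M :: "('p, 'e::euclidean_space) manifold"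
  assumes M: "smooth_manifold M" and f: "smooth_near M p f" and g: "smooth_near M p g"
    and comb: "\<And>(T::'e set) F G. open T \<Longrightarrow> smooth_on T F \<Longrightarrow> smooth_on T G
      \<Longrightarrow> smooth_on T (\<lambda>y. c (F y) (G y))"
  shows "smooth_near M p (\<lambda>q. c (f q) (g q))"
proof -
  obtain U \<phi> where c: "(U, \<phi>) \<in> atlas M" "p \<in> U"
    by (rule chart_exists[OF M smooth_near_in_points[OF f]])
  obtain T1 where T1: "open T1" "\<phi> p \<in> T1" "smooth_on T1 (f \<circ> inv_into U \<phi>)"
    by (rule smooth_near_chartD[OF M c f])
  obtain T2 where T2: "open T2" "\<phi> p \<in> T2" "smooth_on T2 (g \<circ> inv_into U \<phi>)"
    by (rule smooth_near_chartD[OF M c g])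
  have "smooth_on (T1 \<inter> T2) (\<lambda>y. c ((f \<circ> inv_into U \<phi>) y) ((g \<circ> inv_into U \<phi>) y))"
    using T1 T2 by (intro comb smooth_on_subset[OF T1(3)] smooth_on_subset[OF T2(3)]) auto
  then show ?thesis
    using T1 T2 by (intro smooth_near_chartI[OF M c, of "T1 \<inter> T2"]) (auto simp: o_def)
qed

lemma smooth_near_add:
  assumes "smooth_manifold M" "smooth_near M p f" "smooth_near M p g"
  shows "smooth_near M p (\<lambda>q. f q + g q)"
  by (rule smooth_near_combine[OF assms smooth_on_add])

lemma smooth_near_mult:
  assumes "smooth_manifold M" "smooth_near M p f" "smooth_near M p g"
  shows "smooth_near M p (\<lambda>q. f q * g q)"
  by (rule smooth_near_combine[OF assms smooth_on_mult])

lemma smooth_near_coordinate: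
  assumes M: "smooth_manifold M" and c: "(U, \<phi>) \<in> atlas M" "p \<in> U"
  shows "smooth_near M p (\<lambda>q. \<phi> q \<bullet> b)"
proof -
  have "smooth_on (\<phi> ` U) (\<phi> \<circ> inv_into U \<phi>)"
    using smooth_on_transition[OF M c(1) c(1)] by simp
  then have "smooth_on (\<phi> ` U) ((\<lambda>q. \<phi> q \<bullet> b) \<circ> inv_into U \<phi>)"
    using smooth_on_inner_left[OF chart_image_open[OF M c(1)]] by (simp add: o_def)
  then show ?thesis
    using c by (intro smooth_near_chartI[OF M c chart_image_open[OF M c(1)]]) auto
qed


section \<open>Tangent spaces\<close>

lemma smooth_near_differentiable:
  assumes "smooth_manifold M" "(U, \<phi>) \<in> atlas M" "p \<in> U" "smooth_near M p f"
  shows "(f \<circ> inv_into U \<phi>) differentiable (at (\<phi> p))"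
proof -
  obtain T where "open T" "\<phi> p \<in> T" "smooth_on T (f \<circ> inv_into U \<phi>)"
    by (rule smooth_near_chartD[OF assms])
  then show ?thesis using smooth_on_imp_differentiable_at by blast
qed

lemma chart_vector_smooth:
  "smooth_near M p f \<Longrightarrow>
    chart_vector M (U, \<phi>) p w f = frechet_derivative (f \<circ> inv_into U \<phi>) (at (\<phi> p)) w"
  by (simp add: chart_vector_def)

lemma chart_vector_not_smooth: "\<not> smooth_near M p f \<Longrightarrow> chart_vector M c p w f = 0"
  by (cases c) (simp add: chart_vector_def)

lemma linear_chart_vector:
  assumes "smooth_manifold M" "(U, \<phi>) \<in> atlas M" "p \<in> U"
  shows "linear (chart_vector M (U, \<phi>) p)"
proof (rule linearI)
  have lin: "linear (frechet_derivative (f \<circ> inv_into U \<phi>) (at (\<phi> p)))" if "smooth_near M p f" for f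
    using smooth_near_differentiable[OF assms that] by (rule linear_frechet_derivative)
  show "chart_vector M (U, \<phi>) p (v + w) = chart_vector M (U, \<phi>) p v + chart_vector M (U, \<phi>) p w"
    for v w
  proof
    show "chart_vector M (U, \<phi>) p (v + w) f
        = (chart_vector M (U, \<phi>) p v + chart_vector M (U, \<phi>) p w) f" for f
      using lin[of f] by (cases "smooth_near M p f")
        (simp_all add: chart_vector_smooth chart_vector_not_smooth linear_add)
  qed
  show "chart_vector M (U, \<phi>) p (a *\<^sub>R w) = a *\<^sub>R chart_vector M (U, \<phi>) p w" for a w
  proof
    show "chart_vector M (U, \<phi>) p (a *\<^sub>R w) f = (a *\<^sub>R chart_vector M (U, \<phi>) p w) f" for f
      using lin[of f] by (cases "smooth_near M p f")
        (simp_all add: chart_vector_smooth chart_vector_not_smooth linear_cmul scaleR_fun_def)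
  qed
qed

text \<open>The chain rule for the transition map; it shows that the tangent space can be computed in any
  one chart and hence is a vector space.\<close>

lemma chart_vector_change:
  assumes M: "smooth_manifold M" and c: "(U, \<phi>) \<in> atlas M" "p \<in> U"
    and c': "(V, \<psi>) \<in> atlas M" "p \<in> V"
  shows "chart_vector M (U, \<phi>) p w =
    chart_vector M (V, \<psi>) p (frechet_derivative (\<psi> \<circ> inv_into U \<phi>) (at (\<phi> p)) w)"
proof
  fix f
  show "chart_vector M (U, \<phi>) p w f =
    chart_vector M (V, \<psi>) p (frechet_derivative (\<psi> \<circ> inv_into U \<phi>) (at (\<phi> p)) w) f"
  proof (cases "smooth_near M p f")
    case True
    let ?S = "\<phi> ` (U \<inter> V)"
    have S: "open ?S"
      by (rule chart_image_Int_open[OF M c(1) chart_domain_open[OF M c'(1)]])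
    have p: "\<phi> p \<in> ?S" using c c' by auto
    have d: "(\<psi> \<circ> inv_into U \<phi>) differentiable (at (\<phi> p))"
      using smooth_on_imp_differentiable_at[OF smooth_on_transition[OF M c(1) c'(1)] S p] .
    have pp: "(\<psi> \<circ> inv_into U \<phi>) (\<phi> p) = \<psi> p"
      using chart_inverse[OF M c] by simp
    have d': "(f \<circ> inv_into V \<psi>) differentiable (at ((\<psi> \<circ> inv_into U \<phi>) (\<phi> p)))"
      unfolding pp by (rule smooth_near_differentiable[OF M c' True])
    have "(f \<circ> inv_into U \<phi>) y = ((f \<circ> inv_into V \<psi>) \<circ> (\<psi> \<circ> inv_into U \<phi>)) y" if "y \<in> ?S" for y
      using that chart_inverse[OF M c(1)] chart_inverse[OF M c'(1)] by auto
    then have "frechet_derivative (f \<circ> inv_into U \<phi>) (at (\<phi> p))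
        = frechet_derivative ((f \<circ> inv_into V \<psi>) \<circ> (\<psi> \<circ> inv_into U \<phi>)) (at (\<phi> p))"
      using frechet_derivative_transform_within_open[OF smooth_near_differentiable[OF M c True] S p]
      by blast
    also have "\<dots> = frechet_derivative (f \<circ> inv_into V \<psi>) (at (\<psi> p))
        \<circ> frechet_derivative (\<psi> \<circ> inv_into U \<phi>) (at (\<phi> p))"
      unfolding frechet_derivative_compose[OF d d'] pp ..
    finally show ?thesis
      using True by (simp add: chart_vector_smooth)
  qed (simp add: chart_vector_not_smooth)
qed

lemma tangent_space_eq_range:
  assumes M: "smooth_manifold M" and c: "(U, \<phi>) \<in> atlas M" "p \<in> U"
  shows "tangent_space M p = range (chart_vector M (U, \<phi>) p)"
  using chart_vector_change[OF M _ _ c] c unfolding tangent_space_def by blast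

lemma chart_vector_in_tangent_space:
  "(U, \<phi>) \<in> atlas M \<Longrightarrow> p \<in> U \<Longrightarrow> chart_vector M (U, \<phi>) p w \<in> tangent_space M p"
  unfolding tangent_space_def by blast

lemma tangent_space_eq_span:
  assumes M: "smooth_manifold M" and c: "(U, \<phi>) \<in> atlas M" "p \<in> U"
  shows "tangent_space M p = span (chart_vector M (U, \<phi>) p ` Basis)"
  using tangent_space_eq_range[OF assms] linear_span_image[OF linear_chart_vector[OF assms], of Basis]
  by simp

lemma subspace_tangent_space:
  assumes M: "smooth_manifold M" and p: "p \<in> points M"
  shows "subspace (tangent_space M p)"
proof -
  obtain U \<phi> where c: "(U, \<phi>) \<in> atlas M" "p \<in> U"
    by (rule chart_exists[OF M p])
  show ?thesis
    unfolding tangent_space_eq_span[OF M c] by (rule subspace_span)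
qed

lemma tangent_vector_in_chart:
  assumes M: "smooth_manifold M" and x: "x \<in> tangent_space M p"
  obtains U \<phi> w where "(U, \<phi>) \<in> atlas M" "p \<in> U" "x = chart_vector M (U, \<phi>) p w"
  using x that unfolding tangent_space_def by auto

lemma tangent_not_smooth: "x \<in> tangent_space M p \<Longrightarrow> \<not> smooth_near M p f \<Longrightarrow> x f = 0"
  unfolding tangent_space_def by (auto simp: chart_vector_not_smooth)

text \<open>Tangent vectors are local operators.  Both sides are zero for functions that are not smooth
  near \<open>p\<close>.\<close>

lemma tangent_cong:
  assumes M: "smooth_manifold M" and x: "x \<in> tangent_space M p"
    and W: "openin (mtop M) W" "p \<in> W" and eq: "\<And>q. q \<in> W \<Longrightarrow> f q = g q"
  shows "x f = x g"
proof (cases "smooth_near M p f")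
  case True
  obtain U \<phi> w where c: "(U, \<phi>) \<in> atlas M" "p \<in> U" and xw: "x = chart_vector M (U, \<phi>) p w"
    using tangent_vector_in_chart[OF M x] .
  have g: "smooth_near M p g" using smooth_near_cong[OF M W eq True] by blast
  have "(f \<circ> inv_into U \<phi>) y = (g \<circ> inv_into U \<phi>) y" if "y \<in> \<phi> ` (U \<inter> W)" for y
    using that chart_inverse[OF M c(1)] eq by auto
  moreover have "\<phi> p \<in> \<phi> ` (U \<inter> W)" using c W by auto
  ultimately have "frechet_derivative (f \<circ> inv_into U \<phi>) (at (\<phi> p))
      = frechet_derivative (g \<circ> inv_into U \<phi>) (at (\<phi> p))"
    using frechet_derivative_transform_within_open[OF smooth_near_differentiable[OF M c True]
      chart_image_Int_open[OF M c(1) W(1)]] by blast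
  then show ?thesis using True g by (simp add: xw chart_vector_smooth)
next
  case False
  then have "\<not> smooth_near M p g" using smooth_near_cong[OF M W, of g f] eq by metis
  then show ?thesis using False x tangent_not_smooth by metis
qed

lemma tangent_add:
  assumes M: "smooth_manifold M" and x: "x \<in> tangent_space M p"
    and f: "smooth_near M p f" and g: "smooth_near M p g"
  shows "x (\<lambda>q. f q + g q) = x f + x g"
proof -
  obtain U \<phi> w where c: "(U, \<phi>) \<in> atlas M" "p \<in> U" and xw: "x = chart_vector M (U, \<phi>) p w"
    using tangent_vector_in_chart[OF M x] .
  have "((\<lambda>y. (f \<circ> inv_into U \<phi>) y + (g \<circ> inv_into U \<phi>) y) has_derivative
      (\<lambda>v. frechet_derivative (f \<circ> inv_into U \<phi>) (at (\<phi> p)) v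
        + frechet_derivative (g \<circ> inv_into U \<phi>) (at (\<phi> p)) v)) (at (\<phi> p))"
    using smooth_near_differentiable[OF M c] f g frechet_derivative_works
    by (intro has_derivative_add) blast+
  from frechet_derivative_at[OF this] show ?thesis
    using f g smooth_near_add[OF M f g] by (simp add: xw chart_vector_smooth o_def fun_eq_iff)
qed

lemma tangent_mult:
  assumes M: "smooth_manifold M" and x: "x \<in> tangent_space M p"
    and f: "smooth_near M p f" and g: "smooth_near M p g"
  shows "x (\<lambda>q. f q * g q) = x f * g p + f p * x g"
proof -
  obtain U \<phi> w where c: "(U, \<phi>) \<in> atlas M" "p \<in> U" and xw: "x = chart_vector M (U, \<phi>) p w"
    using tangent_vector_in_chart[OF M x] .
  have "((\<lambda>y. (f \<circ> inv_into U \<phi>) y * (g \<circ> inv_into U \<phi>) y) has_derivative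
      (\<lambda>v. (f \<circ> inv_into U \<phi>) (\<phi> p) * frechet_derivative (g \<circ> inv_into U \<phi>) (at (\<phi> p)) v
        + frechet_derivative (f \<circ> inv_into U \<phi>) (at (\<phi> p)) v * (g \<circ> inv_into U \<phi>) (\<phi> p))) (at (\<phi> p))"
    using smooth_near_differentiable[OF M c] f g frechet_derivative_works
    by (intro has_derivative_mult) blast+
  from frechet_derivative_at[OF this] show ?thesis
    using f g smooth_near_mult[OF M f g] chart_inverse[OF M c]
    by (simp add: xw chart_vector_smooth o_def fun_eq_iff add.commute)
qed

lemma chart_vector_coordinate:
  assumes M: "smooth_manifold M" and c: "(U, \<phi>) \<in> atlas M" "p \<in> U"
  shows "chart_vector M (U, \<phi>) p w (\<lambda>q. \<phi> q \<bullet> b) = w \<bullet> b"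
proof -
  let ?f = "\<lambda>q. \<phi> q \<bullet> b"
  have "(?f \<circ> inv_into U \<phi>) y = y \<bullet> b" if "y \<in> \<phi> ` U" for y
    using that chart_inverse[OF M c(1)] by auto
  then have "frechet_derivative (?f \<circ> inv_into U \<phi>) (at (\<phi> p))
      = frechet_derivative (\<lambda>y. y \<bullet> b) (at (\<phi> p))"
    using c(2) by (intro frechet_derivative_transform_within_open[OF
      smooth_near_differentiable[OF M c smooth_near_coordinate[OF M c]]
      chart_image_open[OF M c(1)]]) auto
  moreover
  have "((\<lambda>y. y \<bullet> b) has_derivative (\<lambda>y. y \<bullet> b)) (at (\<phi> p))"
    by (rule bounded_linear_imp_has_derivative[OF bounded_linear_inner_left])
  from frechet_derivative_at[OF this]
  have "frechet_derivative (\<lambda>y. y \<bullet> b) (at (\<phi> p)) w = w \<bullet> b" by metis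
  ultimately show ?thesis
    by (simp only: chart_vector_smooth[OF smooth_near_coordinate[OF M c]])
qed

text \<open>The coefficients of a tangent vector with respect to the coordinate vectors are its values on
  the coordinate functions.  They depend smoothly on the point when the vector varies in a smooth field.\<close>

lemma tangent_vector_eq_sum:
  assumes M: "smooth_manifold M" and c: "(U, \<phi>) \<in> atlas M" "p \<in> U"
    and x: "x \<in> tangent_space M p"
  shows "x = (\<Sum>b\<in>Basis. x (\<lambda>q. \<phi> q \<bullet> b) *\<^sub>R chart_vector M (U, \<phi>) p b)"
proof -
  obtain w where w: "x = chart_vector M (U, \<phi>) p w"
    using x tangent_space_eq_range[OF M c] by blast
  interpret linear "chart_vector M (U, \<phi>) p" by (rule linear_chart_vector[OF M c])
  have "x = chart_vector M (U, \<phi>) p (\<Sum>b\<in>Basis. (w \<bullet> b) *\<^sub>R b)"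
    by (simp add: w euclidean_representation)
  also have "\<dots> = (\<Sum>b\<in>Basis. (w \<bullet> b) *\<^sub>R chart_vector M (U, \<phi>) p b)"
    by (simp only: sum scaleR)
  finally show ?thesis
    unfolding w chart_vector_coordinate[OF M c] .
qed

section \<open>Vector fields\<close>

lemma scaleR_fun_apply: "(c *\<^sub>R f) x = c *\<^sub>R f x"
  by (simp add: scaleR_fun_def)

lemma continuous_preimage_open:
  fixes M :: "('q, 'f) manifold" and N :: "('p, 'e) manifold"
  assumes "continuous_map (mtop M) (mtop N) i" "openin (mtop M) W" "openin (mtop N) U"
  shows "openin (mtop M) {p \<in> W. i p \<in> U}"
proof -
  have "{p \<in> W. i p \<in> U} = W \<inter> {p \<in> points M. i p \<in> U}"
    using openin_subset[OF assms(2)] by auto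
  then show ?thesis
    using openin_Int[OF assms(2) openin_continuous_map_preimage[OF assms(1,3)]] by simp
qed

text \<open>Smoothness of a section only has to be tested on functions that are smooth near a single
  point.\<close>

lemma section_onI:
  assumes M: "smooth_manifold M" and N: "smooth_manifold N"
    and i: "continuous_map (mtop M) (mtop N) i" and W: "openin (mtop M) W"
    and T: "\<And>p. p \<in> W \<Longrightarrow> V p \<in> tangent_space N (i p)"
    and f: "\<And>p f. p \<in> W \<Longrightarrow> smooth_near N (i p) f \<Longrightarrow> smooth_near M p (\<lambda>q. V q f)"
  shows "section_on M N i W V"
  unfolding section_on_def
proof (intro conjI allI impI ballI)
  fix U g assume g: "smooth_fun N U g"
  then have "openin (mtop M) {p \<in> W. i p \<in> U}"
    unfolding smooth_fun_def by (intro continuous_preimage_open[OF i W]) simp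
  moreover have "smooth_near M p (\<lambda>q. V q g)" if "p \<in> {p \<in> W. i p \<in> U}" for p
    using that g unfolding smooth_fun_iff_near[OF N] by (intro f) auto
  ultimately show "smooth_fun M {p \<in> W. i p \<in> U} (\<lambda>p. V p g)"
    unfolding smooth_fun_iff_near[OF M] by simp
qed (fact W T)+

lemma section_onD:
  assumes "section_on M N i W V"
  shows section_on_openin: "openin (mtop M) W"
    and section_on_tangent: "p \<in> W \<Longrightarrow> V p \<in> tangent_space N (i p)"
    and section_on_smooth: "p \<in> W \<Longrightarrow> smooth_near N (i p) f \<Longrightarrow> smooth_near M p (\<lambda>q. V q f)"
proof -
  show "openin (mtop M) W" "p \<in> W \<Longrightarrow> V p \<in> tangent_space N (i p)"
    using assms unfolding section_on_def by blast+
  assume "p \<in> W" "smooth_near N (i p) f"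
  then obtain U where "i p \<in> U" "smooth_fun N U f" unfolding smooth_near_def by blast
  moreover have "smooth_fun M {p \<in> W. i p \<in> U} (\<lambda>p. V p f)"
    using \<open>smooth_fun N U f\<close> assms unfolding section_on_def by blast
  ultimately show "smooth_near M p (\<lambda>q. V q f)"
    using \<open>p \<in> W\<close> unfolding smooth_near_def by (intro exI[of _ "{p \<in> W. i p \<in> U}"]) simp
qed

lemma section_on_subset:
  assumes M: "smooth_manifold M" and N: "smooth_manifold N"
    and i: "continuous_map (mtop M) (mtop N) i"
    and V: "section_on M N i W V" and W': "openin (mtop M) W'" "W' \<subseteq> W"
  shows "section_on M N i W' V"
  using W'(2) by (intro section_onI[OF M N i W'(1)] section_on_tangent[OF V] section_on_smooth[OF V]) auto

lemma section_nearI: "section_on M N i W V \<Longrightarrow> p \<in> W \<Longrightarrow> section_near M N i p V"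
  unfolding section_near_def by blast

lemma section_nearD:
  assumes "section_near M N i p V"
  shows section_near_in_points: "p \<in> points M"
    and section_near_tangent: "V p \<in> tangent_space N (i p)"
    and section_near_smooth: "smooth_near N (i p) f \<Longrightarrow> smooth_near M p (\<lambda>q. V q f)"
proof -
  obtain W where W: "p \<in> W" "section_on M N i W V"
    using assms unfolding section_near_def by blast
  show "p \<in> points M" using section_on_openin[OF W(2)] W(1) openin_subset by blast
  show "V p \<in> tangent_space N (i p)" using section_on_tangent[OF W(2,1)] .
  show "smooth_near N (i p) f \<Longrightarrow> smooth_near M p (\<lambda>q. V q f)"
    using section_on_smooth[OF W(2,1)] .
qed

lemma section_near_add:
  assumes M: "smooth_manifold M" and N: "smooth_manifold N"
    and i: "continuous_map (mtop M) (mtop N) i"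
    and V: "section_near M N i p V" and V': "section_near M N i p V'"
  shows "section_near M N i p (\<lambda>q. V q + V' q)"
proof -
  obtain W where W: "p \<in> W" "section_on M N i W V"
    using V unfolding section_near_def by blast
  obtain W' where W': "p \<in> W'" "section_on M N i W' V'"
    using V' unfolding section_near_def by blast
  have "section_on M N i (W \<inter> W') (\<lambda>q. V q + V' q)"
  proof (rule section_onI[OF M N i])
    show "openin (mtop M) (W \<inter> W')"
      using section_on_openin[OF W(2)] section_on_openin[OF W'(2)] by (rule openin_Int)
    show "V q + V' q \<in> tangent_space N (i q)" if "q \<in> W \<inter> W'" for q
    proof (rule subspace_add)
      have "q \<in> points M" using that openin_subset[OF section_on_openin[OF W(2)]] by blast
      then show "subspace (tangent_space N (i q))"
        using i by (intro subspace_tangent_space[OF N]) (auto simp: continuous_map_def)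
    qed (use that section_on_tangent[OF W(2)] section_on_tangent[OF W'(2)] in auto)
    show "smooth_near M q (\<lambda>q. (V q + V' q) f)" if "q \<in> W \<inter> W'" "smooth_near N (i q) f" for q f
      using that section_on_smooth[OF W(2)] section_on_smooth[OF W'(2)] smooth_near_add[OF M]
      by simp
  qed
  then show ?thesis using W(1) W'(1) by (auto intro: section_nearI)
qed

lemma section_near_scale:
  assumes M: "smooth_manifold M" and N: "smooth_manifold N"
    and i: "continuous_map (mtop M) (mtop N) i"
    and f: "smooth_near M p f" and V: "section_near M N i p V"
  shows "section_near M N i p (\<lambda>q. f q *\<^sub>R V q)"
proof -
  obtain W where W: "p \<in> W" "section_on M N i W V"
    using V unfolding section_near_def by blast
  obtain W' where W': "openin (mtop M) W'" "p \<in> W'" "\<forall>q\<in>W'. smooth_near M q f"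
    by (rule smooth_near_nbhd[OF M f])
  have "section_on M N i (W \<inter> W') (\<lambda>q. f q *\<^sub>R V q)"
  proof (rule section_onI[OF M N i])
    show "openin (mtop M) (W \<inter> W')"
      using section_on_openin[OF W(2)] W'(1) by (rule openin_Int)
    show "f q *\<^sub>R V q \<in> tangent_space N (i q)" if "q \<in> W \<inter> W'" for q
    proof (rule subspace_scale)
      have "q \<in> points M" using that openin_subset[OF section_on_openin[OF W(2)]] by blast
      then show "subspace (tangent_space N (i q))"
        using i by (intro subspace_tangent_space[OF N]) (auto simp: continuous_map_def)
    qed (use that section_on_tangent[OF W(2)] in auto)
    show "smooth_near M q (\<lambda>q. (f q *\<^sub>R V q) g)" if "q \<in> W \<inter> W'" "smooth_near N (i q) g" for q g
      using that section_on_smooth[OF W(2)] W'(3) smooth_near_mult[OF M]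
      by (simp add: scaleR_fun_apply)
  qed
  then show ?thesis using W(1) W'(2) by (auto intro: section_nearI)
qed

lemma section_near_cong:
  assumes M: "smooth_manifold M" and N: "smooth_manifold N"
    and i: "continuous_map (mtop M) (mtop N) i"
    and V: "section_near M N i p V"
    and W: "openin (mtop M) W" "p \<in> W" "\<And>q. q \<in> W \<Longrightarrow> V q = V' q"
  shows "section_near M N i p V'"
proof -
  obtain W' where W': "p \<in> W'" "section_on M N i W' V"
    using V unfolding section_near_def by blast
  have op: "openin (mtop M) (W \<inter> W')"
    using W(1) section_on_openin[OF W'(2)] by (rule openin_Int)
  have "section_on M N i (W \<inter> W') V'"
  proof (rule section_onI[OF M N i op])
    show "V' q \<in> tangent_space N (i q)" if "q \<in> W \<inter> W'" for q
      using section_on_tangent[OF W'(2), of q] that W(3) by simp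
    show "smooth_near M q (\<lambda>q. V' q f)" if "q \<in> W \<inter> W'" "smooth_near N (i q) f" for q f
    proof (rule smooth_near_cong[OF M op])
      show "smooth_near M q (\<lambda>q. V q f)" using section_on_smooth[OF W'(2)] that by simp
    qed (use that W(3) in auto)
  qed
  then show ?thesis using W(2) W'(1) by (auto intro: section_nearI)
qed

lemma continuous_map_ident: "continuous_map X X (\<lambda>p. p)"
  using continuous_map_id by (simp add: id_def)

lemmas vector_field_on_subset = section_on_subset[OF _ _ continuous_map_ident]
lemmas vector_field_near_add = section_near_add[OF _ _ continuous_map_ident]
lemmas vector_field_near_scale = section_near_scale[OF _ _ continuous_map_ident]
lemmas vector_field_near_cong = section_near_cong[OF _ _ continuous_map_ident]

lemma vector_fields_near_common_domain:
  assumes M: "smooth_manifold M" and X: "vector_field_near M p X" and Y: "vector_field_near M p Y"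
  obtains W where "p \<in> W" "vector_field_on M W X" "vector_field_on M W Y"
proof -
  obtain W where W: "p \<in> W" "vector_field_on M W X"
    using X unfolding section_near_def by blast
  obtain W' where W': "p \<in> W'" "vector_field_on M W' Y"
    using Y unfolding section_near_def by blast
  have "openin (mtop M) (W \<inter> W')"
    using section_on_openin[OF W(2)] section_on_openin[OF W'(2)] by (rule openin_Int)
  then show ?thesis
    using that[of "W \<inter> W'"] W W' vector_field_on_subset[OF M M] by simp
qed

lemma smooth_near_chart_vector:
  assumes M: "smooth_manifold M" and c: "(U, \<phi>) \<in> atlas M" "p \<in> U" and f: "smooth_near M p f"
  shows "smooth_near M p (\<lambda>q. chart_vector M (U, \<phi>) q w f)"
proof -
  obtain T where T: "open T" "\<phi> p \<in> T" "smooth_on T (f \<circ> inv_into U \<phi>)"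
    by (rule smooth_near_chartD[OF M c f])
  let ?T = "T \<inter> \<phi> ` U"
  have op: "open ?T" using T(1) chart_image_open[OF M c(1)] by auto
  have "smooth_on ?T (\<lambda>y. frechet_derivative (f \<circ> inv_into U \<phi>) (at y) w)"
    by (intro smooth_on_frechet_derivative smooth_on_subset[OF T(3)]) auto
  moreover have "frechet_derivative (f \<circ> inv_into U \<phi>) (at y) w
      = ((\<lambda>q. chart_vector M (U, \<phi>) q w f) \<circ> inv_into U \<phi>) y" if y: "y \<in> ?T" for y
  proof -
    obtain q where q: "q \<in> U" "y = \<phi> q" using y by auto
    have "smooth_near M q f"
      using y q T by (intro smooth_near_chartI[OF M c(1) q(1) T(1)]) auto
    then show ?thesis
      using q chart_inverse[OF M c(1)] by (simp add: chart_vector_smooth)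
  qed
  ultimately have "smooth_on ?T ((\<lambda>q. chart_vector M (U, \<phi>) q w f) \<circ> inv_into U \<phi>)"
    using smooth_on_cong[OF op, of "\<lambda>y. frechet_derivative (f \<circ> inv_into U \<phi>) (at y) w"
      "(\<lambda>q. chart_vector M (U, \<phi>) q w f) \<circ> inv_into U \<phi>"] by simp
  then show ?thesis
    using T c by (intro smooth_near_chartI[OF M c op]) auto
qed

lemma vector_field_on_chart_vector:
  assumes M: "smooth_manifold M" and c: "(U, \<phi>) \<in> atlas M"
  shows "vector_field_on M U (\<lambda>q. chart_vector M (U, \<phi>) q w)"
  using chart_vector_in_tangent_space[OF c] smooth_near_chart_vector[OF M c]
  by (intro section_onI[OF M M continuous_map_ident chart_domain_open[OF M c]]) auto

lemma tangent_vector_extends: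
  assumes M: "smooth_manifold M" and p: "p \<in> points M" and x: "x \<in> tangent_space M p"
  obtains X where "vector_field_near M p X" "X p = x"
proof -
  obtain U \<phi> w where c: "(U, \<phi>) \<in> atlas M" "p \<in> U" "x = chart_vector M (U, \<phi>) p w"
    using x by (rule tangent_vector_in_chart[OF M])
  show ?thesis
    using that[of "\<lambda>q. chart_vector M (U, \<phi>) q w"]
      section_nearI[OF vector_field_on_chart_vector[OF M c(1)] c(2)] c(3) by simp
qed

text \<open>Near \<open>p\<close> a vector field is the sum of the coordinate fields multiplied by smooth functions.  Thus a
  property that is closed under sums, smooth multiples and local equality holds for all fields once
  it holds for the coordinate fields.\<close>

lemma vector_field_near_induct [consumes 4, case_names coord add scale cong]:
  fixes M :: "('p, 'e::euclidean_space) manifold"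
  assumes M: "smooth_manifold M" and c: "(U, \<phi>) \<in> atlas M" "p \<in> U"
    and X: "vector_field_near M p X"
    and coord: "\<And>b. b \<in> Basis \<Longrightarrow> P (\<lambda>q. chart_vector M (U, \<phi>) q b)"
    and add: "\<And>X Y. vector_field_near M p X \<Longrightarrow> vector_field_near M p Y \<Longrightarrow> P X \<Longrightarrow> P Y
      \<Longrightarrow> P (\<lambda>q. X q + Y q)"
    and scale: "\<And>f X. smooth_near M p f \<Longrightarrow> vector_field_near M p X \<Longrightarrow> P X
      \<Longrightarrow> P (\<lambda>q. f q *\<^sub>R X q)"
    and cong: "\<And>X Y W. vector_field_near M p X \<Longrightarrow> P X \<Longrightarrow> openin (mtop M) W \<Longrightarrow> p \<in> W
      \<Longrightarrow> (\<And>q. q \<in> W \<Longrightarrow> X q = Y q) \<Longrightarrow> P Y"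
  shows "P X"
proof -
  let ?E = "\<lambda>b q. chart_vector M (U, \<phi>) q b"
  have p: "p \<in> points M" by (rule section_near_in_points[OF X])
  have E: "vector_field_near M p (?E b)" for b
    using section_nearI[OF vector_field_on_chart_vector[OF M c(1)] c(2)] .
  have zero: "vector_field_near M p (\<lambda>q. 0) \<and> P (\<lambda>q. 0)"
  proof -
    \<comment> \<open>the zero field is the empty sum; it arises as zero times a coordinate field\<close>
    obtain b :: 'e where b: "b \<in> Basis" using nonempty_Basis by blast
    have "vector_field_near M p (\<lambda>q. 0 *\<^sub>R ?E b q)"
      by (rule vector_field_near_scale[OF M M smooth_near_const[OF M p] E])
    moreover have "P (\<lambda>q. 0 *\<^sub>R ?E b q)"
      by (rule scale[OF smooth_near_const[OF M p] E coord[OF b]])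
    ultimately show ?thesis by simp
  qed
  have sums: "vector_field_near M p (\<lambda>q. \<Sum>b\<in>B. X q (\<lambda>r. \<phi> r \<bullet> b) *\<^sub>R ?E b q)
      \<and> P (\<lambda>q. \<Sum>b\<in>B. X q (\<lambda>r. \<phi> r \<bullet> b) *\<^sub>R ?E b q)" if "finite B" "B \<subseteq> Basis" for B
    using that
  proof (induction B rule: finite_induct)
    case empty
    show ?case using zero by (simp only: sum.empty)
  next
    case (insert b B)
    have s: "smooth_near M p (\<lambda>q. X q (\<lambda>r. \<phi> r \<bullet> b))"
      by (rule section_near_smooth[OF X smooth_near_coordinate[OF M c]])
    have v: "vector_field_near M p (\<lambda>q. X q (\<lambda>r. \<phi> r \<bullet> b) *\<^sub>R ?E b q)"
      by (rule vector_field_near_scale[OF M M s E])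
    have "P (\<lambda>q. X q (\<lambda>r. \<phi> r \<bullet> b) *\<^sub>R ?E b q)"
      using insert.prems by (intro scale[OF s E] coord) auto
    then show ?case
      unfolding sum.insert[OF insert.hyps]
      using insert.IH insert.prems v vector_field_near_add[OF M M v] add[OF v] by blast
  qed
  obtain W where W: "p \<in> W" "vector_field_on M W X"
    using X unfolding section_near_def by blast
  show ?thesis
  proof (rule cong)
    show "vector_field_near M p (\<lambda>q. \<Sum>b\<in>Basis. X q (\<lambda>r. \<phi> r \<bullet> b) *\<^sub>R ?E b q)"
      "P (\<lambda>q. \<Sum>b\<in>Basis. X q (\<lambda>r. \<phi> r \<bullet> b) *\<^sub>R ?E b q)"
      using sums[OF finite_Basis] by auto
    show "openin (mtop M) (W \<inter> U)"
      using section_on_openin[OF W(2)] chart_domain_open[OF M c(1)] by (rule openin_Int)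
    show "p \<in> W \<inter> U" using W c by auto
    show "(\<Sum>b\<in>Basis. X q (\<lambda>r. \<phi> r \<bullet> b) *\<^sub>R ?E b q) = X q" if "q \<in> W \<inter> U" for q
      using tangent_vector_eq_sum[OF M c(1), of q "X q"] section_on_tangent[OF W(2)] that by simp
  qed
qed

text \<open>By induction, \<open>T X\<close> is the combination of the values of \<open>T\<close> on the coordinate fields whose
  coefficients are the components of \<open>X p\<close>.\<close>

lemma tensorial:
  fixes M :: "('p, 'e::euclidean_space) manifold" and T :: "('p \<Rightarrow> 'p tvec) \<Rightarrow> 'v::real_vector"
  assumes M: "smooth_manifold M"
    and cong: "\<And>X Y W. vector_field_near M p X \<Longrightarrow> vector_field_near M p Y \<Longrightarrow> openin (mtop M) W
      \<Longrightarrow> p \<in> W \<Longrightarrow> (\<And>q. q \<in> W \<Longrightarrow> X q = Y q) \<Longrightarrow> T X = T Y"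
    and add: "\<And>X Y. vector_field_near M p X \<Longrightarrow> vector_field_near M p Y
      \<Longrightarrow> T (\<lambda>q. X q + Y q) = T X + T Y"
    and scale: "\<And>f X. smooth_near M p f \<Longrightarrow> vector_field_near M p X
      \<Longrightarrow> T (\<lambda>q. f q *\<^sub>R X q) = f p *\<^sub>R T X"
    and X: "vector_field_near M p X" and Y: "vector_field_near M p Y" and eq: "X p = Y p"
  shows "T X = T Y"
proof -
  obtain U \<phi> where c: "(U, \<phi>) \<in> atlas M" "p \<in> U"
    by (rule chart_exists[OF M section_near_in_points[OF X]])
  let ?E = "\<lambda>b q. chart_vector M (U, \<phi>) q b"
  have "T X = (\<Sum>b\<in>Basis. X p (\<lambda>r. \<phi> r \<bullet> b) *\<^sub>R T (?E b))" if "vector_field_near M p X" for X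
    using M c that
  proof (induction X rule: vector_field_near_induct)
    case (coord a)
    have "(\<Sum>b\<in>Basis. ?E a p (\<lambda>r. \<phi> r \<bullet> b) *\<^sub>R T (?E b))
        = (\<Sum>b\<in>Basis. (if b = a then T (?E b) else 0))"
      using coord by (intro sum.cong)
        (auto simp: chart_vector_coordinate[OF M c] inner_Basis)
    then show ?case using coord by simp
  next
    case (add X Y)
    then show ?case
      unfolding assms(3)[OF add(1,2)] by (simp add: scaleR_add_left sum.distrib)
  next
    case (scale f X)
    then show ?case
      unfolding assms(4)[OF scale(1,2)] by (simp add: scaleR_fun_apply scaleR_sum_right)
  next
    case h: (cong X Y W)
    have "vector_field_near M p Y" by (rule vector_field_near_cong[OF M M h.hyps])
    then have "T X = T Y" using assms(2)[OF h.hyps(1) _ h.hyps(2-4)] by simp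
    moreover have "X p = Y p" using h.hyps(3,4) by simp
    ultimately show ?case using h.IH by simp
  qed
  then show ?thesis using X Y eq by simp
qed


section \<open>Lie brackets\<close>

lemma lie_bracket_apply:
  "smooth_near M p f \<Longrightarrow> lie_bracket M X Y p f = X p (\<lambda>q. Y q f) - Y p (\<lambda>q. X q f)"
  by (simp add: lie_bracket_def)

lemma lie_bracket_antisym: "lie_bracket M Y X p = - lie_bracket M X Y p"
  by (auto simp: lie_bracket_def)

lemma lie_bracket_cong:
  assumes M: "smooth_manifold M"
    and X: "vector_field_near M p X" and Y: "vector_field_near M p Y"
    and W: "openin (mtop M) W" "p \<in> W" "\<And>q. q \<in> W \<Longrightarrow> X q = X' q"
  shows "lie_bracket M X Y p = lie_bracket M X' Y p"
proof
  fix f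
  have "Y p (\<lambda>q. X q f) = Y p (\<lambda>q. X' q f)"
    using W by (intro tangent_cong[OF M section_near_tangent[OF Y]]) auto
  then show "lie_bracket M X Y p f = lie_bracket M X' Y p f"
    using W by (simp add: lie_bracket_def)
qed

lemma lie_bracket_add:
  assumes M: "smooth_manifold M"
    and X: "vector_field_near M p X" and X': "vector_field_near M p X'"
    and Y: "vector_field_near M p Y"
  shows "lie_bracket M (\<lambda>q. X q + X' q) Y p = lie_bracket M X Y p + lie_bracket M X' Y p"
proof
  fix f
  show "lie_bracket M (\<lambda>q. X q + X' q) Y p f = (lie_bracket M X Y p + lie_bracket M X' Y p) f"
  proof (cases "smooth_near M p f")
    case True
    have "Y p (\<lambda>q. X q f + X' q f) = Y p (\<lambda>q. X q f) + Y p (\<lambda>q. X' q f)"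
      using section_near_smooth[OF X True] section_near_smooth[OF X' True]
      by (rule tangent_add[OF M section_near_tangent[OF Y]])
    then show ?thesis by (simp add: lie_bracket_def)
  qed (simp add: lie_bracket_def)
qed

lemma lie_bracket_scale:
  assumes M: "smooth_manifold M" and f: "smooth_near M p f"
    and X: "vector_field_near M p X" and Y: "vector_field_near M p Y"
  shows "lie_bracket M (\<lambda>q. f q *\<^sub>R X q) Y p = f p *\<^sub>R lie_bracket M X Y p - Y p f *\<^sub>R X p"
proof
  fix g
  show "lie_bracket M (\<lambda>q. f q *\<^sub>R X q) Y p g
      = (f p *\<^sub>R lie_bracket M X Y p - Y p f *\<^sub>R X p) g"
  proof (cases "smooth_near M p g")
    case True
    have "Y p (\<lambda>q. f q * X q g) = Y p f * X p g + f p * Y p (\<lambda>q. X q g)"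
      using f section_near_smooth[OF X True]
      by (rule tangent_mult[OF M section_near_tangent[OF Y]])
    then show ?thesis using True by (simp add: lie_bracket_def scaleR_fun_apply algebra_simps)
  next
    case False
    then show ?thesis
      using tangent_not_smooth[OF section_near_tangent[OF X]]
      by (simp add: lie_bracket_def scaleR_fun_apply)
  qed
qed

text \<open>This is the symmetry of second derivatives, read in the chart.\<close>

lemma lie_bracket_coordinate_fields:
  assumes M: "smooth_manifold M" and c: "(U, \<phi>) \<in> atlas M" "p \<in> U"
  shows "lie_bracket M (\<lambda>q. chart_vector M (U, \<phi>) q v) (\<lambda>q. chart_vector M (U, \<phi>) q w) p = 0"
proof
  fix f
  show "lie_bracket M (\<lambda>q. chart_vector M (U, \<phi>) q v) (\<lambda>q. chart_vector M (U, \<phi>) q w) p f = 0 f"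
  proof (cases "smooth_near M p f")
    case True
    let ?F = "f \<circ> inv_into U \<phi>"
    obtain T where T: "open T" "\<phi> p \<in> T" "smooth_on T ?F"
      by (rule smooth_near_chartD[OF M c True])
    let ?T = "T \<inter> \<phi> ` U"
    have op: "open ?T" using T(1) chart_image_open[OF M c(1)] by auto
    have p: "\<phi> p \<in> ?T" using T c by auto
    have "chart_vector M (U, \<phi>) p v (\<lambda>q. chart_vector M (U, \<phi>) q w f)
        = frechet_derivative (\<lambda>y. frechet_derivative ?F (at y) w) (at (\<phi> p)) v" for v w
    proof -
      have s: "smooth_near M p (\<lambda>q. chart_vector M (U, \<phi>) q w f)"
        by (rule smooth_near_chart_vector[OF M c True])
      have "((\<lambda>q. chart_vector M (U, \<phi>) q w f) \<circ> inv_into U \<phi>) y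
          = frechet_derivative ?F (at y) w" if y: "y \<in> ?T" for y
      proof -
        obtain q where q: "q \<in> U" "y = \<phi> q" using y by auto
        have "smooth_near M q f"
          using y q T by (intro smooth_near_chartI[OF M c(1) q(1) T(1)]) auto
        then show ?thesis
          using q chart_inverse[OF M c(1)] by (simp add: chart_vector_smooth)
      qed
      then have "frechet_derivative ((\<lambda>q. chart_vector M (U, \<phi>) q w f) \<circ> inv_into U \<phi>) (at (\<phi> p))
          = frechet_derivative (\<lambda>y. frechet_derivative ?F (at y) w) (at (\<phi> p))"
        by (rule frechet_derivative_transform_within_open[OF
              smooth_near_differentiable[OF M c s] op p])
      then show ?thesis by (simp add: chart_vector_smooth[OF s])
    qed
    then show ?thesis
      using frechet_derivative_commute[OF T(3,1,2)] True by (simp add: lie_bracket_apply)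
  qed (simp add: lie_bracket_def)
qed

text \<open>By definition the bracket is just an operator on functions.  Sums, smooth multiples and local
  equality in either argument preserve the property of being tangent, so it reduces to brackets of two
  coordinate fields, which vanish.\<close>

lemma lie_bracket_tangent:
  fixes M :: "('p, 'e::euclidean_space) manifold"
  assumes M: "smooth_manifold M"
    and X: "vector_field_near M p X" and Y: "vector_field_near M p Y"
  shows "lie_bracket M X Y p \<in> tangent_space M p"
proof -
  have p: "p \<in> points M" by (rule section_near_in_points[OF X])
  obtain U \<phi> where c: "(U, \<phi>) \<in> atlas M" "p \<in> U"
    by (rule chart_exists[OF M p])
  have sub: "subspace (tangent_space M p)" by (rule subspace_tangent_space[OF M p])
  have step: "lie_bracket M X Y p \<in> tangent_space M p"
    if Y: "vector_field_near M p Y" and X: "vector_field_near M p X"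
      and E: "\<And>b. b \<in> Basis \<Longrightarrow>
        lie_bracket M (\<lambda>q. chart_vector M (U, \<phi>) q b) Y p \<in> tangent_space M p" for X Y
    using M c X
  proof (induction X rule: vector_field_near_induct)
    case (coord b)
    then show ?case by (rule E)
  next
    case (add X X')
    then show ?case
      unfolding lie_bracket_add[OF M add(1,2) Y] by (intro subspace_add[OF sub])
  next
    case (scale f X)
    have "X p \<in> tangent_space M p" by (rule section_near_tangent[OF scale(2)])
    then show ?case
      unfolding lie_bracket_scale[OF M scale(1,2) Y] using scale(3)
      by (intro subspace_diff[OF sub] subspace_scale[OF sub])
  next
    case h: (cong X X' W)
    then show ?case using lie_bracket_cong[OF M h.hyps(1) Y h.hyps(2-4)] by simp
  qed
  have E: "vector_field_near M p (\<lambda>q. chart_vector M (U, \<phi>) q b)" for b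
    using section_nearI[OF vector_field_on_chart_vector[OF M c(1)] c(2)] .
  \<comment> \<open>the reduction is used for one argument and, by antisymmetry, again for the other\<close>
  have "lie_bracket M Y (\<lambda>q. chart_vector M (U, \<phi>) q b) p \<in> tangent_space M p" for b
    using subspace_0[OF sub]
    by (intro step[OF E Y]) (simp add: lie_bracket_coordinate_fields[OF M c])
  then have "lie_bracket M (\<lambda>q. chart_vector M (U, \<phi>) q b) Y p \<in> tangent_space M p" for b
    using subspace_neg[OF sub] by (metis lie_bracket_antisym)
  then show ?thesis by (intro step[OF Y X])
qed

section \<open>Curvature of a connection\<close>

lemma linear_on_add: "linear_on V f \<Longrightarrow> x \<in> V \<Longrightarrow> y \<in> V \<Longrightarrow> f (x + y) = f x + f y"
  unfolding linear_on_def by blast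

lemma linear_on_scale: "linear_on V f \<Longrightarrow> x \<in> V \<Longrightarrow> f (c *\<^sub>R x) = c *\<^sub>R f x"
  unfolding linear_on_def by blast

lemma linear_on_neg: "linear_on V f \<Longrightarrow> x \<in> V \<Longrightarrow> f (- x) = - f x"
  using linear_on_scale[of V f x "-1"] by simp

lemma linear_on_diff:
  assumes "linear_on V f" "x \<in> V" "y \<in> V" "subspace V"
  shows "f (x - y) = f x - f y"
  using linear_on_add[OF assms(1,2) subspace_neg[OF assms(4,3)]] linear_on_neg[OF assms(1,3)] by simp

lemma connection_alongD:
  assumes "connection_along M N i D"
  shows connection_section_on: "vector_field_on M W X \<Longrightarrow> section_on M N i W V
      \<Longrightarrow> section_on M N i W (\<lambda>p. D p (X p) V)"
    and connection_linear: "section_near M N i p V \<Longrightarrow> linear_on (tangent_space M p) (\<lambda>x. D p x V)"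
    and connection_add: "x \<in> tangent_space M p \<Longrightarrow> section_near M N i p V \<Longrightarrow> section_near M N i p V'
      \<Longrightarrow> D p x (\<lambda>q. V q + V' q) = D p x V + D p x V'"
    and connection_leibniz: "x \<in> tangent_space M p \<Longrightarrow> smooth_near M p f \<Longrightarrow> section_near M N i p V
      \<Longrightarrow> D p x (\<lambda>q. f q *\<^sub>R V q) = x f *\<^sub>R V p + f p *\<^sub>R D p x V"
    and connection_cong: "x \<in> tangent_space M p \<Longrightarrow> section_near M N i p V \<Longrightarrow> section_near M N i p V'
      \<Longrightarrow> openin (mtop M) W \<Longrightarrow> p \<in> W \<Longrightarrow> (\<And>q. q \<in> W \<Longrightarrow> V q = V' q) \<Longrightarrow> D p x V = D p x V'"
proof -
  note * = assms[unfolded connection_along_def]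
  show "section_on M N i W (\<lambda>p. D p (X p) V)" if "vector_field_on M W X" "section_on M N i W V"
    using * that by simp
  show "linear_on (tangent_space M p) (\<lambda>x. D p x V)" if "section_near M N i p V"
    using * that section_near_in_points[OF that] by simp
  show "D p x (\<lambda>q. V q + V' q) = D p x V + D p x V'"
    if "x \<in> tangent_space M p" "section_near M N i p V" "section_near M N i p V'"
    using * that section_near_in_points[OF that(2)] by simp
  show "D p x (\<lambda>q. f q *\<^sub>R V q) = x f *\<^sub>R V p + f p *\<^sub>R D p x V"
    if "x \<in> tangent_space M p" "smooth_near M p f" "section_near M N i p V"
    using * that section_near_in_points[OF that(3)] by simp
  show "D p x V = D p x V'"
    if "x \<in> tangent_space M p" "section_near M N i p V" "section_near M N i p V'"
      "openin (mtop M) W" "p \<in> W" "\<And>q. q \<in> W \<Longrightarrow> V q = V' q"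
  proof -
    have "\<forall>p\<in>points M. \<forall>x\<in>tangent_space M p. \<forall>V V' W. section_near M N i p V \<longrightarrow>
        section_near M N i p V' \<longrightarrow> openin (mtop M) W \<longrightarrow> p \<in> W \<longrightarrow> (\<forall>q\<in>W. V q = V' q) \<longrightarrow>
        D p x V = D p x V'"
      using * by (elim conjE)
    from this[rule_format, OF section_near_in_points[OF that(2)] that] show ?thesis .
  qed
qed

context
  fixes M :: "('p, 'e::euclidean_space) manifold" and D :: "('p, 'p) connection"
  assumes M: "smooth_manifold M" and conn: "connection_along M M (\<lambda>p. p) D"
begin

lemma connection_vector_field_near:
  assumes "vector_field_near M p X" "vector_field_near M p Z"
  shows "vector_field_near M p (\<lambda>q. D q (X q) Z)"
proof -
  obtain W where "p \<in> W" "vector_field_on M W X" "vector_field_on M W Z"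
    using assms by (rule vector_fields_near_common_domain[OF M])
  then show ?thesis
    using connection_section_on[OF conn] by (auto intro: section_nearI)
qed

lemma curvature_field_antisym:
  assumes X: "vector_field_near M p X" and Y: "vector_field_near M p Y" and Z: "vector_field_near M p Z"
  shows "curvature_field M D Y X Z p = - curvature_field M D X Y Z p"
  unfolding curvature_field_def lie_bracket_antisym[of M Y X p]
  by (simp add: linear_on_neg[OF connection_linear[OF conn Z] lie_bracket_tangent[OF M X Y]])

lemma curvature_field_cong1:
  assumes X: "vector_field_near M p X" and X': "vector_field_near M p X'"
    and Y: "vector_field_near M p Y" and Z: "vector_field_near M p Z"
    and W: "openin (mtop M) W" "p \<in> W" "\<And>q. q \<in> W \<Longrightarrow> X q = X' q"
  shows "curvature_field M D X Y Z p = curvature_field M D X' Y Z p"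
proof -
  have "D p (Y p) (\<lambda>q. D q (X q) Z) = D p (Y p) (\<lambda>q. D q (X' q) Z)"
    using W by (intro connection_cong[OF conn section_near_tangent[OF Y]
          connection_vector_field_near[OF X Z] connection_vector_field_near[OF X' Z] W(1)]) auto
  then show ?thesis
    unfolding curvature_field_def using W lie_bracket_cong[OF M X Y W] by simp
qed

lemma curvature_field_add1:
  assumes X: "vector_field_near M p X" and X': "vector_field_near M p X'"
    and Y: "vector_field_near M p Y" and Z: "vector_field_near M p Z"
  shows "curvature_field M D (\<lambda>q. X q + X' q) Y Z p
    = curvature_field M D X Y Z p + curvature_field M D X' Y Z p"
proof -
  note XX = vector_field_near_add[OF M M X X']
  note DX = connection_vector_field_near[OF X Z] and DX' = connection_vector_field_near[OF X' Z]
  obtain W1 where W1: "p \<in> W1" "vector_field_on M W1 X" "vector_field_on M W1 Z"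
    using X Z by (rule vector_fields_near_common_domain[OF M])
  obtain W2 where W2: "p \<in> W2" "vector_field_on M W2 X'"
    using X' unfolding section_near_def by blast
  have op: "openin (mtop M) (W1 \<inter> W2)"
    using section_on_openin[OF W1(2)] section_on_openin[OF W2(2)] by (rule openin_Int)
  have "D p (Y p) (\<lambda>q. D q (X q + X' q) Z) = D p (Y p) (\<lambda>q. D q (X q) Z + D q (X' q) Z)"
  proof (rule connection_cong[OF conn section_near_tangent[OF Y]
        connection_vector_field_near[OF XX Z] vector_field_near_add[OF M M DX DX'] op])
    show "D q (X q + X' q) Z = D q (X q) Z + D q (X' q) Z" if "q \<in> W1 \<inter> W2" for q
      using that section_on_tangent[OF W1(2)] section_on_tangent[OF W2(2)]
      by (intro linear_on_add[OF connection_linear[OF conn]] section_nearI[OF W1(3)]) auto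
  qed (use W1 W2 in auto)
  also have "\<dots> = D p (Y p) (\<lambda>q. D q (X q) Z) + D p (Y p) (\<lambda>q. D q (X' q) Z)"
    by (rule connection_add[OF conn section_near_tangent[OF Y] DX DX'])
  finally have 1: "D p (Y p) (\<lambda>q. D q (X q + X' q) Z)
      = D p (Y p) (\<lambda>q. D q (X q) Z) + D p (Y p) (\<lambda>q. D q (X' q) Z)" .
  have 2: "D p (X p + X' p) (\<lambda>q. D q (Y q) Z)
      = D p (X p) (\<lambda>q. D q (Y q) Z) + D p (X' p) (\<lambda>q. D q (Y q) Z)"
    by (rule linear_on_add[OF connection_linear[OF conn connection_vector_field_near[OF Y Z]]
          section_near_tangent[OF X] section_near_tangent[OF X']])
  have 3: "D p (lie_bracket M X Y p + lie_bracket M X' Y p) Z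
      = D p (lie_bracket M X Y p) Z + D p (lie_bracket M X' Y p) Z"
    by (rule linear_on_add[OF connection_linear[OF conn Z]
          lie_bracket_tangent[OF M X Y] lie_bracket_tangent[OF M X' Y]])
  show ?thesis
    unfolding curvature_field_def lie_bracket_add[OF M X X' Y] 1 2 3
    by (simp only: algebra_simps)
qed

text \<open>The derivative of \<open>f\<close> that \<open>D\<^sub>Y (f D\<^sub>X Z)\<close> produces is cancelled by the one in
  \<open>[f X, Y] = f [X, Y] - (Y f) X\<close>.\<close>

lemma curvature_field_scale1:
  assumes f: "smooth_near M p f" and X: "vector_field_near M p X"
    and Y: "vector_field_near M p Y" and Z: "vector_field_near M p Z"
  shows "curvature_field M D (\<lambda>q. f q *\<^sub>R X q) Y Z p = f p *\<^sub>R curvature_field M D X Y Z p"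
proof -
  note fX = vector_field_near_scale[OF M M f X]
  note DX = connection_vector_field_near[OF X Z]
  have sub: "subspace (tangent_space M p)"
    by (rule subspace_tangent_space[OF M section_near_in_points[OF X]])
  have Xp: "X p \<in> tangent_space M p" by (rule section_near_tangent[OF X])
  obtain W where W: "p \<in> W" "vector_field_on M W X" "vector_field_on M W Z"
    using X Z by (rule vector_fields_near_common_domain[OF M])
  have "D p (Y p) (\<lambda>q. D q (f q *\<^sub>R X q) Z) = D p (Y p) (\<lambda>q. f q *\<^sub>R D q (X q) Z)"
  proof (rule connection_cong[OF conn section_near_tangent[OF Y]
        connection_vector_field_near[OF fX Z] vector_field_near_scale[OF M M f DX]
        section_on_openin[OF W(2)] W(1)])
    show "D q (f q *\<^sub>R X q) Z = f q *\<^sub>R D q (X q) Z" if "q \<in> W" for q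
      using that section_on_tangent[OF W(2)]
      by (intro linear_on_scale[OF connection_linear[OF conn]] section_nearI[OF W(3)]) auto
  qed
  also have "\<dots> = Y p f *\<^sub>R D p (X p) Z + f p *\<^sub>R D p (Y p) (\<lambda>q. D q (X q) Z)"
    by (rule connection_leibniz[OF conn section_near_tangent[OF Y] f DX])
  finally have 1: "D p (Y p) (\<lambda>q. D q (f q *\<^sub>R X q) Z)
      = Y p f *\<^sub>R D p (X p) Z + f p *\<^sub>R D p (Y p) (\<lambda>q. D q (X q) Z)" .
  have 2: "D p (f p *\<^sub>R X p) (\<lambda>q. D q (Y q) Z) = f p *\<^sub>R D p (X p) (\<lambda>q. D q (Y q) Z)"
    by (rule linear_on_scale[OF connection_linear[OF conn connection_vector_field_near[OF Y Z]] Xp])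
  have B: "lie_bracket M X Y p \<in> tangent_space M p" by (rule lie_bracket_tangent[OF M X Y])
  have 3: "D p (f p *\<^sub>R lie_bracket M X Y p - Y p f *\<^sub>R X p) Z
      = f p *\<^sub>R D p (lie_bracket M X Y p) Z - Y p f *\<^sub>R D p (X p) Z"
    using linear_on_diff[OF connection_linear[OF conn Z] subspace_scale[OF sub B]
        subspace_scale[OF sub Xp] sub]
      linear_on_scale[OF connection_linear[OF conn Z] B]
      linear_on_scale[OF connection_linear[OF conn Z] Xp] by simp
  show ?thesis
    unfolding curvature_field_def lie_bracket_scale[OF M f X Y] 1 2 3
    by (simp only: scaleR_diff_right algebra_simps)
qed

lemma curvature_field_cong3:
  assumes X: "vector_field_near M p X" and Y: "vector_field_near M p Y"
    and Z: "vector_field_near M p Z" and Z': "vector_field_near M p Z'"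
    and W: "openin (mtop M) W" "p \<in> W" "\<And>q. q \<in> W \<Longrightarrow> Z q = Z' q"
  shows "curvature_field M D X Y Z p = curvature_field M D X Y Z' p"
proof -
  have DD: "D p (X p) (\<lambda>q. D q (Y q) Z) = D p (X p) (\<lambda>q. D q (Y q) Z')"
    if X: "vector_field_near M p X" and Y: "vector_field_near M p Y" for X Y
  proof -
    obtain W1 where W1: "p \<in> W1" "vector_field_on M W1 Y" "vector_field_on M W1 Z"
      using Y Z by (rule vector_fields_near_common_domain[OF M])
    obtain W2 where W2: "p \<in> W2" "vector_field_on M W2 Z'"
      using Z' unfolding section_near_def by blast
    have op: "openin (mtop M) (W1 \<inter> W2 \<inter> W)"
      using section_on_openin[OF W1(2)] section_on_openin[OF W2(2)] W(1) by auto
    show ?thesis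
    proof (rule connection_cong[OF conn section_near_tangent[OF X]
          connection_vector_field_near[OF Y Z] connection_vector_field_near[OF Y Z'] op])
      show "D q (Y q) Z = D q (Y q) Z'" if "q \<in> W1 \<inter> W2 \<inter> W" for q
        using that W(3)
        by (intro connection_cong[OF conn section_on_tangent[OF W1(2)] section_nearI[OF W1(3)]
              section_nearI[OF W2(2)] W(1)]) auto
    qed (use W W1 W2 in auto)
  qed
  have "D p (lie_bracket M X Y p) Z = D p (lie_bracket M X Y p) Z'"
    by (rule connection_cong[OF conn lie_bracket_tangent[OF M X Y] Z Z' W])
  then show ?thesis
    unfolding curvature_field_def DD[OF X Y] DD[OF Y X] by simp
qed

lemma curvature_field_add3:
  assumes X: "vector_field_near M p X" and Y: "vector_field_near M p Y"
    and Z: "vector_field_near M p Z" and Z': "vector_field_near M p Z'"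
  shows "curvature_field M D X Y (\<lambda>q. Z q + Z' q) p
    = curvature_field M D X Y Z p + curvature_field M D X Y Z' p"
proof -
  note ZZ = vector_field_near_add[OF M M Z Z']
  have DD: "D p (X p) (\<lambda>q. D q (Y q) (\<lambda>q. Z q + Z' q))
      = D p (X p) (\<lambda>q. D q (Y q) Z) + D p (X p) (\<lambda>q. D q (Y q) Z')"
    if X: "vector_field_near M p X" and Y: "vector_field_near M p Y" for X Y
  proof -
    note DZ = connection_vector_field_near[OF Y Z] and DZ' = connection_vector_field_near[OF Y Z']
    obtain W1 where W1: "p \<in> W1" "vector_field_on M W1 Y" "vector_field_on M W1 Z"
      using Y Z by (rule vector_fields_near_common_domain[OF M])
    obtain W2 where W2: "p \<in> W2" "vector_field_on M W2 Z'"
      using Z' unfolding section_near_def by blast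
    have op: "openin (mtop M) (W1 \<inter> W2)"
      using section_on_openin[OF W1(2)] section_on_openin[OF W2(2)] by (rule openin_Int)
    have "D p (X p) (\<lambda>q. D q (Y q) (\<lambda>q. Z q + Z' q))
        = D p (X p) (\<lambda>q. D q (Y q) Z + D q (Y q) Z')"
    proof (rule connection_cong[OF conn section_near_tangent[OF X]
          connection_vector_field_near[OF Y ZZ] vector_field_near_add[OF M M DZ DZ'] op])
      show "D q (Y q) (\<lambda>q. Z q + Z' q) = D q (Y q) Z + D q (Y q) Z'" if "q \<in> W1 \<inter> W2" for q
        using that
        by (intro connection_add[OF conn section_on_tangent[OF W1(2)] section_nearI[OF W1(3)]
              section_nearI[OF W2(2)]]) auto
    qed (use W1 W2 in auto)
    then show ?thesis
      using connection_add[OF conn section_near_tangent[OF X] DZ DZ'] by simp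
  qed
  show ?thesis
    unfolding curvature_field_def DD[OF X Y] DD[OF Y X]
      connection_add[OF conn lie_bracket_tangent[OF M X Y] Z Z']
    by (simp only: algebra_simps)
qed

text \<open>The first derivatives of \<open>f\<close> appear symmetrically in \<open>X\<close> and \<open>Y\<close> and cancel; the second ones
  combine to \<open>(XYf - YXf) Z\<close>, which is the term \<open>([X, Y] f) Z\<close> from the Leibniz rule for the bracket.\<close>

lemma curvature_field_scale3:
  assumes f: "smooth_near M p f" and X: "vector_field_near M p X"
    and Y: "vector_field_near M p Y" and Z: "vector_field_near M p Z"
  shows "curvature_field M D X Y (\<lambda>q. f q *\<^sub>R Z q) p = f p *\<^sub>R curvature_field M D X Y Z p"
proof -
  note fZ = vector_field_near_scale[OF M M f Z]
  have DD: "D p (X p) (\<lambda>q. D q (Y q) (\<lambda>q. f q *\<^sub>R Z q))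
      = X p (\<lambda>q. Y q f) *\<^sub>R Z p + Y p f *\<^sub>R D p (X p) Z
        + (X p f *\<^sub>R D p (Y p) Z + f p *\<^sub>R D p (X p) (\<lambda>q. D q (Y q) Z))"
    if X: "vector_field_near M p X" and Y: "vector_field_near M p Y" for X Y
  proof -
    note DZ = connection_vector_field_near[OF Y Z]
    have Yf: "smooth_near M p (\<lambda>q. Y q f)" by (rule section_near_smooth[OF Y f])
    note YfZ = vector_field_near_scale[OF M M Yf Z] and fDZ = vector_field_near_scale[OF M M f DZ]
    have Xp: "X p \<in> tangent_space M p" by (rule section_near_tangent[OF X])
    obtain W1 where W1: "p \<in> W1" "vector_field_on M W1 Y" "vector_field_on M W1 Z"
      using Y Z by (rule vector_fields_near_common_domain[OF M])
    obtain W2 where W2: "openin (mtop M) W2" "p \<in> W2" "\<forall>q\<in>W2. smooth_near M q f"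
      by (rule smooth_near_nbhd[OF M f])
    have op: "openin (mtop M) (W1 \<inter> W2)"
      using section_on_openin[OF W1(2)] W2(1) by (rule openin_Int)
    have "D p (X p) (\<lambda>q. D q (Y q) (\<lambda>q. f q *\<^sub>R Z q))
        = D p (X p) (\<lambda>q. Y q f *\<^sub>R Z q + f q *\<^sub>R D q (Y q) Z)"
    proof (rule connection_cong[OF conn Xp
          connection_vector_field_near[OF Y fZ] vector_field_near_add[OF M M YfZ fDZ] op])
      show "D q (Y q) (\<lambda>q. f q *\<^sub>R Z q) = Y q f *\<^sub>R Z q + f q *\<^sub>R D q (Y q) Z"
        if "q \<in> W1 \<inter> W2" for q
        using that W2(3)
        by (intro connection_leibniz[OF conn section_on_tangent[OF W1(2)] _ section_nearI[OF W1(3)]])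
          auto
    qed (use W1 W2 in auto)
    also have "\<dots> = D p (X p) (\<lambda>q. Y q f *\<^sub>R Z q) + D p (X p) (\<lambda>q. f q *\<^sub>R D q (Y q) Z)"
      by (rule connection_add[OF conn Xp YfZ fDZ])
    finally show ?thesis
      unfolding connection_leibniz[OF conn Xp Yf Z] connection_leibniz[OF conn Xp f DZ] .
  qed
  have B: "D p (lie_bracket M X Y p) (\<lambda>q. f q *\<^sub>R Z q)
      = (X p (\<lambda>q. Y q f) - Y p (\<lambda>q. X q f)) *\<^sub>R Z p + f p *\<^sub>R D p (lie_bracket M X Y p) Z"
    unfolding connection_leibniz[OF conn lie_bracket_tangent[OF M X Y] f Z] lie_bracket_apply[OF f] ..
  show ?thesis
    unfolding curvature_field_def DD[OF X Y] DD[OF Y X] B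
    by (simp only: scaleR_diff_left scaleR_diff_right algebra_simps)
qed

lemma curvature_field_tensorial1:
  assumes "vector_field_near M p X" "vector_field_near M p X'" "X p = X' p"
    and Y: "vector_field_near M p Y" and Z: "vector_field_near M p Z"
  shows "curvature_field M D X Y Z p = curvature_field M D X' Y Z p"
  using curvature_field_cong1[OF _ _ Y Z] curvature_field_add1[OF _ _ Y Z]
    curvature_field_scale1[OF _ _ Y Z] assms(1,2,3)
  by (rule tensorial[OF M])

lemma curvature_field_tensorial3:
  assumes X: "vector_field_near M p X" and Y: "vector_field_near M p Y"
    and "vector_field_near M p Z" "vector_field_near M p Z'" "Z p = Z' p"
  shows "curvature_field M D X Y Z p = curvature_field M D X Y Z' p"
  using curvature_field_cong3[OF X Y] curvature_field_add3[OF X Y]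
    curvature_field_scale3[OF _ X Y] assms(3,4,5)
  by (rule tensorial[OF M])

text \<open>The description by \<open>THE\<close> is meaningful because any extensions give the same value.  The fields
  are exchanged one at a time; the second slot is reduced to the first by antisymmetry.\<close>

lemma curvature_eq_curvature_field:
  assumes X: "vector_field_near M p X" and Y: "vector_field_near M p Y" and Z: "vector_field_near M p Z"
  shows "curvature M D p (X p) (Y p) (Z p) = curvature_field M D X Y Z p"
  unfolding curvature_def
proof (rule the_equality)
  show "\<forall>X' Y' Z'. vector_field_near M p X' \<and> vector_field_near M p Y' \<and> vector_field_near M p Z'
      \<and> X' p = X p \<and> Y' p = Y p \<and> Z' p = Z p
      \<longrightarrow> curvature_field M D X' Y' Z' p = curvature_field M D X Y Z p"
  proof (intro allI impI, elim conjE)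
    fix X' Y' Z'
    assume X': "vector_field_near M p X'" and Y': "vector_field_near M p Y'"
      and Z': "vector_field_near M p Z'" and eq: "X' p = X p" "Y' p = Y p" "Z' p = Z p"
    have "curvature_field M D X' Y' Z' p = curvature_field M D X Y' Z' p"
      by (rule curvature_field_tensorial1[OF X' X eq(1) Y' Z'])
    also have "\<dots> = - curvature_field M D Y' X Z' p"
      by (rule curvature_field_antisym[OF Y' X Z'])
    also have "\<dots> = - curvature_field M D Y X Z' p"
      by (simp only: curvature_field_tensorial1[OF Y' Y eq(2) X Z'])
    also have "\<dots> = curvature_field M D X Y Z' p"
      by (rule curvature_field_antisym[OF Y X Z', symmetric])
    also have "\<dots> = curvature_field M D X Y Z p"
      by (rule curvature_field_tensorial3[OF X Y Z' Z eq(3)])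
    finally show "curvature_field M D X' Y' Z' p = curvature_field M D X Y Z p" .
  qed
qed (use X Y Z in blast)

lemma curvature_in_tangent_space:
  assumes p: "p \<in> points M"
    and "x \<in> tangent_space M p" "y \<in> tangent_space M p" "z \<in> tangent_space M p"
  shows "curvature M D p x y z \<in> tangent_space M p"
proof -
  obtain X where X: "vector_field_near M p X" "X p = x"
    by (rule tangent_vector_extends[OF M p assms(2)])
  obtain Y where Y: "vector_field_near M p Y" "Y p = y"
    by (rule tangent_vector_extends[OF M p assms(3)])
  obtain Z where Z: "vector_field_near M p Z" "Z p = z"
    by (rule tangent_vector_extends[OF M p assms(4)])
  have sub: "subspace (tangent_space M p)" by (rule subspace_tangent_space[OF M p])
  \<comment> \<open>the bracket is extended to a field so that its covariant derivative is seen to be tangent\<close>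
  obtain B where B: "vector_field_near M p B" "B p = lie_bracket M X Y p"
    by (rule tangent_vector_extends[OF M p lie_bracket_tangent[OF M X(1) Y(1)]])
  have "curvature_field M D X Y Z p \<in> tangent_space M p"
    unfolding curvature_field_def B(2)[symmetric]
    by (intro subspace_diff[OF sub] section_near_tangent[OF connection_vector_field_near]
        X Y Z B connection_vector_field_near)
  then show ?thesis
    using curvature_eq_curvature_field[OF X(1) Y(1) Z(1)] X(2) Y(2) Z(2) by simp
qed

lemma curvature_linear2:
  assumes p: "p \<in> points M" and x: "x \<in> tangent_space M p" and z: "z \<in> tangent_space M p"
  shows "linear_on (tangent_space M p) (\<lambda>y. curvature M D p x y z)"
proof -
  obtain X where X: "vector_field_near M p X" "X p = x"
    by (rule tangent_vector_extends[OF M p x])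
  obtain Z where Z: "vector_field_near M p Z" "Z p = z"
    by (rule tangent_vector_extends[OF M p z])
  have eq: "curvature M D p x (Y p) z = - curvature_field M D Y X Z p"
    if "vector_field_near M p Y" for Y
    using curvature_eq_curvature_field[OF X(1) that Z(1)] curvature_field_antisym[OF that X(1) Z(1)]
      X(2) Z(2) by simp
  show ?thesis
    unfolding linear_on_def
  proof (intro conjI ballI allI)
    fix y1 y2 assume y: "y1 \<in> tangent_space M p" "y2 \<in> tangent_space M p"
    obtain Y1 where Y1: "vector_field_near M p Y1" "Y1 p = y1"
      by (rule tangent_vector_extends[OF M p y(1)])
    obtain Y2 where Y2: "vector_field_near M p Y2" "Y2 p = y2"
      by (rule tangent_vector_extends[OF M p y(2)])
    show "curvature M D p x (y1 + y2) z = curvature M D p x y1 z + curvature M D p x y2 z"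
      using eq[OF Y1(1)] eq[OF Y2(1)] eq[OF vector_field_near_add[OF M M Y1(1) Y2(1)]]
        curvature_field_add1[OF Y1(1) Y2(1) X(1) Z(1)] Y1(2) Y2(2)
      by (metis minus_add_distrib)
  next
    fix c y assume y: "y \<in> tangent_space M p"
    obtain Y where Y: "vector_field_near M p Y" "Y p = y"
      by (rule tangent_vector_extends[OF M p y])
    note c = smooth_near_const[OF M p, of c]
    show "curvature M D p x (c *\<^sub>R y) z = c *\<^sub>R curvature M D p x y z"
      using eq[OF Y(1)] eq[OF vector_field_near_scale[OF M M c Y(1)]]
        curvature_field_scale1[OF c Y(1) X(1) Z(1)] Y(2)
      by (metis scaleR_minus_right)
  qed
qed

end

section \<open>Traces on finite-dimensional subspaces\<close>

lemma linear_on_0: "linear_on V f \<Longrightarrow> 0 \<in> V \<Longrightarrow> f 0 = 0"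
  using linear_on_scale[of V f 0 0] by simp

lemma linear_on_sum:
  assumes f: "linear_on V f" and V: "subspace V" and e: "\<And>j. j \<in> A \<Longrightarrow> e j \<in> V"
  shows "f (\<Sum>j\<in>A. c j *\<^sub>R e j) = (\<Sum>j\<in>A. c j *\<^sub>R f (e j))"
  using e
proof (induction A rule: infinite_finite_induct)
  case (insert a A)
  have "c a *\<^sub>R e a \<in> V" "(\<Sum>j\<in>A. c j *\<^sub>R e j) \<in> V"
    using insert.prems by (auto intro!: subspace_scale[OF V] subspace_sum[OF V])
  then show ?case
    using insert linear_on_add[OF f] linear_on_scale[OF f, of "e a"] by simp
qed (simp_all add: linear_on_0[OF f subspace_0[OF V]])

text \<open>Linear forms dual to a spanning family compute the coefficients of a vector.  This is used for the
  null transversal sections, with the forms \<open>g(\<xi>\<^sub>j, -)\<close>, and for the radical, with the forms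
  \<open>g(-, N\<^sub>j)\<close>.\<close>

lemma span_dual_expansion:
  assumes V: "subspace V" and A: "finite A" and e: "\<And>j. j \<in> A \<Longrightarrow> e j \<in> V"
    and \<alpha>: "\<And>j. j \<in> A \<Longrightarrow> linear_on V (\<alpha> j)"
    and dual: "\<And>j k. j \<in> A \<Longrightarrow> k \<in> A \<Longrightarrow> \<alpha> j (e k) = (if j = k then 1 else 0 :: real)"
    and v: "v \<in> span (e ` A)"
  shows "v = (\<Sum>j\<in>A. \<alpha> j v *\<^sub>R e j)"
proof -
  have "subspace {v \<in> V. v = (\<Sum>j\<in>A. \<alpha> j v *\<^sub>R e j)}"
    unfolding subspace_def
  proof (intro conjI ballI allI)
    show "0 \<in> {v \<in> V. v = (\<Sum>j\<in>A. \<alpha> j v *\<^sub>R e j)}"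
      using subspace_0[OF V] linear_on_0[OF \<alpha>] by simp
  next
    fix v w
    assume *: "v \<in> {v \<in> V. v = (\<Sum>j\<in>A. \<alpha> j v *\<^sub>R e j)}" "w \<in> {v \<in> V. v = (\<Sum>j\<in>A. \<alpha> j v *\<^sub>R e j)}"
    then have vw: "v \<in> V" "w \<in> V" by auto
    have "(\<Sum>j\<in>A. \<alpha> j (v + w) *\<^sub>R e j) = (\<Sum>j\<in>A. \<alpha> j v *\<^sub>R e j) + (\<Sum>j\<in>A. \<alpha> j w *\<^sub>R e j)"
      using linear_on_add[OF \<alpha> vw] by (simp add: scaleR_add_left sum.distrib)
    then show "v + w \<in> {v \<in> V. v = (\<Sum>j\<in>A. \<alpha> j v *\<^sub>R e j)}"
      using * subspace_add[OF V vw] by simp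
  next
    fix c v assume *: "v \<in> {v \<in> V. v = (\<Sum>j\<in>A. \<alpha> j v *\<^sub>R e j)}"
    then have v: "v \<in> V" by auto
    have "(\<Sum>j\<in>A. \<alpha> j (c *\<^sub>R v) *\<^sub>R e j) = c *\<^sub>R (\<Sum>j\<in>A. \<alpha> j v *\<^sub>R e j)"
      using linear_on_scale[OF \<alpha> v] by (simp add: scaleR_sum_right)
    then show "c *\<^sub>R v \<in> {v \<in> V. v = (\<Sum>j\<in>A. \<alpha> j v *\<^sub>R e j)}"
      using * subspace_scale[OF V v] by simp
  qed
  moreover have "e ` A \<subseteq> {v \<in> V. v = (\<Sum>j\<in>A. \<alpha> j v *\<^sub>R e j)}"
  proof safe
    fix k assume k: "k \<in> A"
    show "e k \<in> V" by (rule e[OF k])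
    have "(\<Sum>j\<in>A. \<alpha> j (e k) *\<^sub>R e j) = (\<Sum>j\<in>A. if j = k then e j else 0)"
      using dual k by (intro sum.cong) auto
    then show "e k = (\<Sum>j\<in>A. \<alpha> j (e k) *\<^sub>R e j)" using A k by simp
  qed
  ultimately show ?thesis
    using span_minimal v by blast
qed

text \<open>All traces on one space are taken with respect to the same basis, so they can be compared term by
  term.\<close>

lemma trace_on_eq_sum:
  assumes V: "subspace V"
  obtains B where "independent B" "span B = V"
    "\<forall>f. trace_on V f = (\<Sum>b\<in>B. representation B (f b) b)"
proof -
  define B where "B = (SOME B. independent B \<and> span B = V)"
  obtain B0 where "B0 \<subseteq> V" "independent B0" "V \<subseteq> span B0"
    by (rule basis_exists)
  then have "independent B0 \<and> span B0 = V"
    using span_minimal[OF _ V] by blast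
  then have "independent B \<and> span B = V"
    unfolding B_def by (rule someI)
  then show ?thesis
    using that[of B] by (simp add: trace_on_def B_def[symmetric])
qed

lemma trace_on_cong:
  assumes V: "subspace V" and eq: "\<And>v. v \<in> V \<Longrightarrow> f v = g v"
  shows "trace_on V f = trace_on V g"
proof -
  obtain B where B: "independent B" "span B = V"
    and tr: "\<forall>f. trace_on V f = (\<Sum>b\<in>B. representation B (f b) b)"
    by (rule trace_on_eq_sum[OF V]) 
  have "f b = g b" if "b \<in> B" for b
    using eq span_base[OF that] B(2) by simp
  then show ?thesis unfolding tr[rule_format] by simp
qed

lemma trace_on_diff:
  assumes V: "subspace V" and f: "\<And>v. v \<in> V \<Longrightarrow> f v \<in> V" and g: "\<And>v. v \<in> V \<Longrightarrow> g v \<in> V"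
  shows "trace_on V (\<lambda>v. f v - g v) = trace_on V f - trace_on V g"
proof -
  obtain B where B: "independent B" "span B = V"
    and tr: "\<forall>f. trace_on V f = (\<Sum>b\<in>B. representation B (f b) b)"
    by (rule trace_on_eq_sum[OF V])
  have "representation B (f b - g b) b = representation B (f b) b - representation B (g b) b"
    if "b \<in> B" for b
  proof -
    have "f b \<in> span B" "g b \<in> span B"
      using f[of b] g[of b] span_base[OF that] unfolding B(2) by auto
    then show ?thesis by (simp add: representation_diff[OF B(1)])
  qed
  then show ?thesis unfolding tr[rule_format] by (simp add: sum_subtractf)
qed

text \<open>For a basis \<open>B\<close> the trace of \<open>v \<mapsto> \<alpha>(v) \<xi>\<close> is the sum of \<open>\<alpha>(b)\<close> times the \<open>b\<close>-coefficient of
  \<open>\<xi>\<close>, and this is \<open>\<alpha>(\<xi>)\<close> by linearity.\<close>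

lemma trace_on_sum_rank_one:
  assumes V: "subspace V" and fin: "finite C" "V \<subseteq> span C"
    and \<alpha>: "\<And>j. j \<in> A \<Longrightarrow> linear_on V (\<alpha> j)" and \<xi>: "\<And>j. j \<in> A \<Longrightarrow> \<xi> j \<in> V"
  shows "trace_on V (\<lambda>v. \<Sum>j\<in>A. \<alpha> j v *\<^sub>R \<xi> j) = (\<Sum>j\<in>A. \<alpha> j (\<xi> j))"
proof -
  obtain B where B: "independent B" "span B = V"
    and tr: "\<forall>f. trace_on V f = (\<Sum>b\<in>B. representation B (f b) b)"
    by (rule trace_on_eq_sum[OF V])
  have BV: "b \<in> V" if "b \<in> B" for b
    using span_base[OF that] B(2) by simp
  then have finB: "finite B"
    using independent_span_bound[OF fin(1) B(1)] fin(2) by blast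
  have one: "(\<Sum>b\<in>B. \<alpha> j b * representation B (\<xi> j) b) = \<alpha> j (\<xi> j)" if j: "j \<in> A" for j
  proof -
    have "\<xi> j = (\<Sum>b\<in>B. representation B (\<xi> j) b *\<^sub>R b)"
      using sum_representation_eq[OF B(1) _ finB subset_refl, of "\<xi> j"] \<xi>[OF j] B(2) by simp
    then have "\<alpha> j (\<xi> j) = \<alpha> j (\<Sum>b\<in>B. representation B (\<xi> j) b *\<^sub>R b)" by simp
    also have "\<dots> = (\<Sum>b\<in>B. representation B (\<xi> j) b *\<^sub>R \<alpha> j b)"
      by (rule linear_on_sum[OF \<alpha>[OF j] V BV])
    finally show ?thesis by (simp add: mult.commute)
  qed
  have rep: "representation B (\<Sum>j\<in>A. \<alpha> j b *\<^sub>R \<xi> j) b = (\<Sum>j\<in>A. \<alpha> j b * representation B (\<xi> j) b)"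
    for b
  proof -
    have "\<xi> j \<in> span B" if "j \<in> A" for j using \<xi>[OF that] B(2) by simp
    then show ?thesis
      using representation_sum[OF B(1), of A "\<lambda>j. \<alpha> j b *\<^sub>R \<xi> j"]
        representation_scale[OF B(1)] span_scale by (simp add: span_scale)
  qed
  have "trace_on V (\<lambda>v. \<Sum>j\<in>A. \<alpha> j v *\<^sub>R \<xi> j) = (\<Sum>b\<in>B. \<Sum>j\<in>A. \<alpha> j b * representation B (\<xi> j) b)"
    unfolding tr[rule_format] rep ..
  also have "\<dots> = (\<Sum>j\<in>A. \<alpha> j (\<xi> j))"
    by (subst sum.swap) (simp add: one)
  finally show ?thesis .
qed

text \<open>The pointwise core of the result: \<open>g\<close> is a degenerate symmetric form, the vectors \<open>\<xi>\<^sub>j\<close> lie in its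
  radical with dual forms \<open>\<eta>\<^sub>j\<close>, and \<open>gt\<close> is the form completed by the squares of the \<open>\<eta>\<^sub>j\<close>.  Since
  \<open>gt(\<xi>\<^sub>j, -) = \<eta>\<^sub>j\<close>, the operator \<open>J\<close> differs from \<open>- F\<close> exactly by the rank-one operators
  \<open>y \<mapsto> \<eta>\<^sub>j(F y) \<xi>\<^sub>j\<close>.\<close>

lemma trace_degenerate_jacobi:
  fixes g :: "'v::real_vector \<Rightarrow> 'v \<Rightarrow> real"
  assumes V: "subspace V" "finite C" "V \<subseteq> span C"
    and g: "\<And>w. w \<in> V \<Longrightarrow> linear_on V (\<lambda>v. g v w)"
    and sym: "\<And>v w. v \<in> V \<Longrightarrow> w \<in> V \<Longrightarrow> g v w = g w v"
    and \<eta>: "\<And>j. j \<in> A \<Longrightarrow> linear_on V (\<eta> j)"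
    and A: "finite A"
    and \<xi>: "\<And>j. j \<in> A \<Longrightarrow> \<xi> j \<in> V"
    and rad: "\<And>j w. j \<in> A \<Longrightarrow> w \<in> V \<Longrightarrow> g (\<xi> j) w = 0"
    and dual: "\<And>j k. j \<in> A \<Longrightarrow> k \<in> A \<Longrightarrow> \<eta> j (\<xi> k) = (if j = k then 1 else 0)"
    and nondeg: "\<And>v. v \<in> V \<Longrightarrow> (\<And>w. w \<in> V \<Longrightarrow> g v w = 0) \<Longrightarrow> (\<And>j. j \<in> A \<Longrightarrow> \<eta> j v = 0) \<Longrightarrow> v = 0"
    and F: "linear_on V F" "\<And>v. v \<in> V \<Longrightarrow> F v \<in> V"
    and gt: "\<And>v w. gt v w = g v w + (\<Sum>j\<in>A. \<eta> j v * \<eta> j w)"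
    and J: "\<And>y. y \<in> V \<Longrightarrow> J y = (THE v. v \<in> V \<and> (\<forall>w\<in>V. gt v w = - g (F y) w))"
  shows "trace_on V J = (\<Sum>j\<in>A. \<eta> j (F (\<xi> j))) - trace_on V F"
proof -
  have gt_lin: "linear_on V (\<lambda>v. gt v w)" if w: "w \<in> V" for w
    unfolding linear_on_def gt
    by (auto simp: linear_on_add[OF g[OF w]] linear_on_scale[OF g[OF w]] linear_on_add[OF \<eta>]
        linear_on_scale[OF \<eta>] algebra_simps sum.distrib sum_distrib_left)
  have gt_\<xi>: "gt (\<xi> k) w = \<eta> k w" if "k \<in> A" "w \<in> V" for k w
  proof -
    have "(\<Sum>j\<in>A. \<eta> j (\<xi> k) * \<eta> j w) = (\<Sum>j\<in>A. if j = k then \<eta> j w else 0)"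
      using dual that by (intro sum.cong) auto
    then show ?thesis
      using that A rad by (simp add: gt)
  qed
  have gt_nondeg: "v = 0" if v: "v \<in> V" and 0: "\<And>w. w \<in> V \<Longrightarrow> gt v w = 0" for v
  proof (rule nondeg[OF v])
    show eta0: "\<eta> k v = 0" if k: "k \<in> A" for k
    proof -
      have "gt v (\<xi> k) = gt (\<xi> k) v"
        using sym[OF v \<xi>[OF k]] by (simp add: gt mult.commute)
      then show ?thesis using 0[OF \<xi>[OF k]] gt_\<xi>[OF k v] by simp
    qed
    show "g v w = 0" if "w \<in> V" for w
      using 0[OF that] eta0 by (simp add: gt)
  qed
  have J_eq: "J y = (\<Sum>j\<in>A. \<eta> j (F y) *\<^sub>R \<xi> j) - F y" if y: "y \<in> V" for y
    unfolding J[OF y]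
  proof (rule the_equality)
    have sV: "(\<Sum>j\<in>A. \<eta> j (F y) *\<^sub>R \<xi> j) \<in> V"
      by (intro subspace_sum[OF V(1)] subspace_scale[OF V(1)] \<xi>)
    have "gt ((\<Sum>j\<in>A. \<eta> j (F y) *\<^sub>R \<xi> j) - F y) w = - g (F y) w" if w: "w \<in> V" for w
    proof -
      have "gt (\<Sum>j\<in>A. \<eta> j (F y) *\<^sub>R \<xi> j) w = (\<Sum>j\<in>A. \<eta> j (F y) *\<^sub>R gt (\<xi> j) w)"
        by (rule linear_on_sum[OF gt_lin[OF w] V(1) \<xi>])
      also have "\<dots> = (\<Sum>j\<in>A. \<eta> j (F y) * \<eta> j w)"
        using gt_\<xi>[OF _ w] by simp
      finally show ?thesis
        unfolding linear_on_diff[OF gt_lin[OF w] sV F(2)[OF y] V(1)] by (simp add: gt)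
    qed
    then show sol: "(\<Sum>j\<in>A. \<eta> j (F y) *\<^sub>R \<xi> j) - F y \<in> V
        \<and> (\<forall>w\<in>V. gt ((\<Sum>j\<in>A. \<eta> j (F y) *\<^sub>R \<xi> j) - F y) w = - g (F y) w)"
      using subspace_diff[OF V(1) sV F(2)[OF y]] by blast
    fix v assume v: "v \<in> V \<and> (\<forall>w\<in>V. gt v w = - g (F y) w)"
    have "v - ((\<Sum>j\<in>A. \<eta> j (F y) *\<^sub>R \<xi> j) - F y) = 0"
    proof (rule gt_nondeg)
      show "v - ((\<Sum>j\<in>A. \<eta> j (F y) *\<^sub>R \<xi> j) - F y) \<in> V"
        using v conjunct1[OF sol] by (intro subspace_diff[OF V(1) conjunct1[OF v]])
      show "gt (v - ((\<Sum>j\<in>A. \<eta> j (F y) *\<^sub>R \<xi> j) - F y)) w = 0" if w: "w \<in> V" for w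
        using linear_on_diff[OF gt_lin[OF w] _ _ V(1), of v "(\<Sum>j\<in>A. \<eta> j (F y) *\<^sub>R \<xi> j) - F y"]
          v sol w by simp
    qed
    then show "v = (\<Sum>j\<in>A. \<eta> j (F y) *\<^sub>R \<xi> j) - F y" by simp
  qed
  have \<eta>F: "linear_on V (\<lambda>y. \<eta> j (F y))" if j: "j \<in> A" for j
    unfolding linear_on_def
    using linear_on_add[OF F(1)] linear_on_scale[OF F(1)] F(2)
      linear_on_add[OF \<eta>[OF j]] linear_on_scale[OF \<eta>[OF j]] by simp
  have "trace_on V J = trace_on V (\<lambda>y. (\<Sum>j\<in>A. \<eta> j (F y) *\<^sub>R \<xi> j) - F y)"
    by (rule trace_on_cong[OF V(1) J_eq])
  also have "\<dots> = trace_on V (\<lambda>y. \<Sum>j\<in>A. \<eta> j (F y) *\<^sub>R \<xi> j) - trace_on V F"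
    by (intro trace_on_diff[OF V(1)] F(2) subspace_sum[OF V(1)] subspace_scale[OF V(1)] \<xi>)
  also have "trace_on V (\<lambda>y. \<Sum>j\<in>A. \<eta> j (F y) *\<^sub>R \<xi> j) = (\<Sum>j\<in>A. \<eta> j (F (\<xi> j)))"
    by (rule trace_on_sum_rank_one[OF V \<eta>F \<xi>])
  finally show ?thesis .
qed


section \<open>The differential of a smooth map\<close>

lemma pushforward_add: "pushforward N i p (x + y) = pushforward N i p x + pushforward N i p y"
  by (auto simp: pushforward_def)

lemma pushforward_scale: "pushforward N i p (c *\<^sub>R x) = c *\<^sub>R pushforward N i p x"
  by (auto simp: pushforward_def scaleR_fun_def)

lemma linear_pushforward: "linear (pushforward N i p)"
  by (intro linearI pushforward_add pushforward_scale)

context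
  fixes M :: "('q, 'f::euclidean_space) manifold" and N :: "('p, 'e::euclidean_space) manifold"
    and i :: "'q \<Rightarrow> 'p"
  assumes M: "smooth_manifold M" and N: "smooth_manifold N" and i: "smooth_map M N i"
begin

lemma smooth_map_continuous: "continuous_map (mtop M) (mtop N) i"
  using i unfolding smooth_map_def by (elim conjE)

lemma smooth_map_in_points: "p \<in> points M \<Longrightarrow> i p \<in> points N"
  using smooth_map_continuous by (auto simp: continuous_map_def)

lemma smooth_map_in_charts:
  assumes "(U, \<phi>) \<in> atlas M" "(V, \<psi>) \<in> atlas N"
  shows "smooth_on (\<phi> ` {q \<in> U. i q \<in> V}) (\<psi> \<circ> i \<circ> inv_into U \<phi>)"
proof -
  have "\<forall>(U, \<phi>)\<in>atlas M. \<forall>(V, \<psi>)\<in>atlas N.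
        smooth_on (\<phi> ` {p\<in>U. i p \<in> V}) (\<psi> \<circ> i \<circ> inv_into U \<phi>)"
    using i unfolding smooth_map_def by (elim conjE)
  from bspec[OF bspec[OF this assms(1), simplified] assms(2)] show ?thesis by simp
qed

lemma chart_image_preimage_open:
  assumes c: "(U, \<phi>) \<in> atlas M" and V: "openin (mtop N) V"
  shows "open (\<phi> ` {q \<in> U. i q \<in> V})"
proof -
  have "U \<inter> {q \<in> U. i q \<in> V} = {q \<in> U. i q \<in> V}" by auto
  then show ?thesis
    using chart_image_Int_open[OF M c continuous_preimage_open[OF smooth_map_continuous
          chart_domain_open[OF M c] V]] by simp
qed

lemma smooth_near_compose:
  assumes p: "p \<in> points M" and f: "smooth_near N (i p) f"
  shows "smooth_near M p (f \<circ> i)"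
proof -
  obtain U \<phi> where c: "(U, \<phi>) \<in> atlas M" "p \<in> U"
    by (rule chart_exists[OF M p])
  obtain V \<psi> where d: "(V, \<psi>) \<in> atlas N" "i p \<in> V"
    by (rule chart_exists[OF N smooth_map_in_points[OF p]])
  obtain T where T: "open T" "\<psi> (i p) \<in> T" "smooth_on T (f \<circ> inv_into V \<psi>)"
    by (rule smooth_near_chartD[OF N d f])
  define V' where "V' = {r \<in> V. \<psi> r \<in> T}"
  let ?S = "\<phi> ` {q \<in> U. i q \<in> V'}"
  have V': "openin (mtop N) V'" unfolding V'_def by (rule chart_preimage_open[OF N d(1) T(1)])
  have S: "open ?S" by (rule chart_image_preimage_open[OF c(1) V'])
  have "smooth_on ?S (\<psi> \<circ> i \<circ> inv_into U \<phi>)"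
    using smooth_map_in_charts[OF c(1) d(1)] by (rule smooth_on_subset) (auto simp: V'_def)
  moreover have "(\<psi> \<circ> i \<circ> inv_into U \<phi>) ` ?S \<subseteq> T"
    using chart_inverse[OF M c(1)] by (auto simp: V'_def)
  ultimately have "smooth_on ?S (\<lambda>y. (f \<circ> inv_into V \<psi>) ((\<psi> \<circ> i \<circ> inv_into U \<phi>) y))"
    using smooth_on_compose[OF S T(1) _ T(3)] by blast
  moreover have "(f \<circ> inv_into V \<psi>) ((\<psi> \<circ> i \<circ> inv_into U \<phi>) y) = ((f \<circ> i) \<circ> inv_into U \<phi>) y"
    if "y \<in> ?S" for y
    using that chart_inverse[OF M c(1)] chart_inverse[OF N d(1)] by (auto simp: V'_def)
  ultimately have "smooth_on ?S ((f \<circ> i) \<circ> inv_into U \<phi>)"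
    using smooth_on_cong[OF S, of "\<lambda>y. (f \<circ> inv_into V \<psi>) ((\<psi> \<circ> i \<circ> inv_into U \<phi>) y)"
        "(f \<circ> i) \<circ> inv_into U \<phi>"] by simp
  then show ?thesis
    using c d T by (intro smooth_near_chartI[OF M c S]) (auto simp: V'_def)
qed

text \<open>In charts the pushforward is the derivative of the map applied to the coordinate vector, by the chain
  rule.\<close>

lemma pushforward_tangent:
  assumes p: "p \<in> points M" and x: "x \<in> tangent_space M p"
  shows "pushforward N i p x \<in> tangent_space N (i p)"
proof -
  obtain U \<phi> w where c: "(U, \<phi>) \<in> atlas M" "p \<in> U" and xw: "x = chart_vector M (U, \<phi>) p w"
    using x by (rule tangent_vector_in_chart[OF M])
  obtain V \<psi> where d: "(V, \<psi>) \<in> atlas N" "i p \<in> V"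
    by (rule chart_exists[OF N smooth_map_in_points[OF p]])
  let ?i = "\<psi> \<circ> i \<circ> inv_into U \<phi>"
  let ?S = "\<phi> ` {q \<in> U. i q \<in> V}"
  have S: "open ?S" by (rule chart_image_preimage_open[OF c(1) chart_domain_open[OF N d(1)]])
  have pS: "\<phi> p \<in> ?S" using c d by auto
  have di: "?i differentiable (at (\<phi> p))"
    by (rule smooth_on_imp_differentiable_at[OF smooth_map_in_charts[OF c(1) d(1)] S pS])
  have pp: "?i (\<phi> p) = \<psi> (i p)" using chart_inverse[OF M c] by simp
  have "pushforward N i p x
      = chart_vector N (V, \<psi>) (i p) (frechet_derivative ?i (at (\<phi> p)) w)"
  proof
    fix f
    show "pushforward N i p x f
      = chart_vector N (V, \<psi>) (i p) (frechet_derivative ?i (at (\<phi> p)) w) f"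
    proof (cases "smooth_near N (i p) f")
      case True
      have fi: "smooth_near M p (f \<circ> i)" by (rule smooth_near_compose[OF p True])
      have df: "(f \<circ> inv_into V \<psi>) differentiable (at (?i (\<phi> p)))"
        unfolding pp by (rule smooth_near_differentiable[OF N d True])
      have "((f \<circ> i) \<circ> inv_into U \<phi>) y = ((f \<circ> inv_into V \<psi>) \<circ> ?i) y" if "y \<in> ?S" for y
        using that chart_inverse[OF M c(1)] chart_inverse[OF N d(1)] by auto
      then have "frechet_derivative ((f \<circ> i) \<circ> inv_into U \<phi>) (at (\<phi> p))
          = frechet_derivative ((f \<circ> inv_into V \<psi>) \<circ> ?i) (at (\<phi> p))"
        by (rule frechet_derivative_transform_within_open[OF
              smooth_near_differentiable[OF M c fi] S pS])
      also have "\<dots> = frechet_derivative (f \<circ> inv_into V \<psi>) (at (\<psi> (i p)))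
          \<circ> frechet_derivative ?i (at (\<phi> p))"
        unfolding frechet_derivative_compose[OF di df] pp ..
      finally show ?thesis
        using True by (simp add: pushforward_def xw chart_vector_smooth[OF fi]
            chart_vector_smooth[OF True])
    qed (simp add: pushforward_def chart_vector_not_smooth)
  qed
  then show ?thesis
    using chart_vector_in_tangent_space[OF d] by simp
qed

lemma section_near_pushforward:
  assumes Y: "vector_field_near M p Y"
  shows "section_near M N i p (\<lambda>q. pushforward N i q (Y q))"
proof -
  obtain W where W: "p \<in> W" "vector_field_on M W Y"
    using Y unfolding section_near_def by blast
  have op: "openin (mtop M) W" by (rule section_on_openin[OF W(2)])
  have pts: "q \<in> points M" if "q \<in> W" for q using that openin_subset[OF op] by blast
  have "section_on M N i W (\<lambda>q. pushforward N i q (Y q))"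
  proof (rule section_onI[OF M N smooth_map_continuous op])
    show "pushforward N i q (Y q) \<in> tangent_space N (i q)" if "q \<in> W" for q
      by (rule pushforward_tangent[OF pts[OF that] section_on_tangent[OF W(2) that]])
    fix q f assume q: "q \<in> W" and f: "smooth_near N (i q) f"
    obtain V where V: "openin (mtop N) V" "i q \<in> V" "\<forall>r\<in>V. smooth_near N r f"
      by (rule smooth_near_nbhd[OF N f])
    show "smooth_near M q (\<lambda>q. pushforward N i q (Y q) f)"
    proof (rule smooth_near_cong[OF M continuous_preimage_open[OF smooth_map_continuous op V(1)]])
      show "smooth_near M q (\<lambda>q. Y q (f \<circ> i))"
        by (rule section_on_smooth[OF W(2) q smooth_near_compose[OF pts[OF q] f]])
    qed (use q V in \<open>auto simp: pushforward_def\<close>)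
  qed
  then show ?thesis using W(1) by (rule section_nearI)
qed

end

section \<open>The induced connection\<close>

lemma bilinear_onD:
  assumes "bilinear_on V b" "x \<in> V"
  shows bilinear_on_right: "linear_on V (\<lambda>y. b x y)"
    and bilinear_on_left: "linear_on V (\<lambda>y. b y x)"
  using assms unfolding bilinear_on_def by auto

lemma smooth_subbundle_subspace:
  assumes "smooth_subbundle M N i k E" "p \<in> points M"
  shows "subspace (E p)"
proof -
  obtain W s where "p \<in> W" "\<forall>p\<in>W. basis_family k (\<lambda>j. s j p) (E p)"
    using assms unfolding smooth_subbundle_def by blast
  then have "E p = span ((\<lambda>j. s j p) ` {1..k})"
    unfolding basis_family_def by blast
  then show ?thesis by (simp add: subspace_span)
qed

text \<open>Let \<open>v + w\<close> be tangent, with \<open>v\<close> in the span of the null sections \<open>n\<^sub>j\<close> and \<open>w\<close> in the screen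
  transversal bundle.  Tangent and normal vectors are orthogonal to the radical, so pairing with \<open>\<xi>\<^sub>j\<close>
  leaves the \<open>j\<close>-th coefficient of \<open>v\<close>, which is therefore zero.  Then \<open>w\<close> is both tangent and normal, that is
  in the radical, and the radical meets the screen transversal bundle in zero.\<close>

lemma transversal_space_complement:
  assumes N: "smooth_manifold N" and ip: "i p \<in> points N" and p: "p \<in> points M"
    and b: "bilinear_on (tangent_space N (i p)) (b (i p))"
    and sym: "symmetric_on (tangent_space N (i p)) (b (i p))"
    and St: "screen_transversal_bundle M N i b St"
    and L: "lightlike_transversal_bundle M N i b r S St L"
  shows subspace_transversal_space: "subspace (transversal_space L St p)"
    and tangent_transversal_disjoint: "tangent_image M N i p \<inter> transversal_space L St p \<subseteq> {0}"
proof -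
  let ?T = "tangent_space N (i p)"
  obtain W \<xi> n where pW: "p \<in> W" and fr: "lightlike_frame M N i b r S St W \<xi> n"
    and Lp: "\<forall>p\<in>W. L p = span ((\<lambda>j. n j p) ` {1..r})"
    using L p unfolding lightlike_transversal_bundle_def by blast
  have T: "subspace ?T" by (rule subspace_tangent_space[OF N ip])
  have n: "n j p \<in> ?T" if "j \<in> {1..r}" for j
    using fr that pW section_on_tangent[of M N i W "n j" p] unfolding lightlike_frame_def by blast
  define x where "x = (\<lambda>j. pushforward N i p (\<xi> j p))"
  have basis: "basis_family r x (radical M N i b p)"
    using fr pW unfolding lightlike_frame_def x_def by blast
  have x: "x j \<in> radical M N i b p" if "j \<in> {1..r}" for j
    using basis that span_base[of "x j" "x ` {1..r}"] unfolding basis_family_def by blast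
  then have xT: "x j \<in> ?T" and xt: "x j \<in> tangent_image M N i p"
    and xn: "w \<in> tangent_image M N i p \<Longrightarrow> b (i p) (x j) w = 0" if "j \<in> {1..r}" for j w
    using that unfolding radical_def normal_space_def perp_in_def by blast+
  have dual: "b (i p) (x j) (n k p) = (if j = k then 1 else 0)" if "j \<in> {1..r}" "k \<in> {1..r}" for j k
    using fr pW that unfolding lightlike_frame_def x_def by blast
  have Stn: "direct_sum (normal_space M N i b p) (radical M N i b p) (St p)"
    and "\<exists>k. smooth_subbundle M N i k St"
    using St p unfolding screen_transversal_bundle_def by blast+
  then have St_sub: "subspace (St p)"
    using smooth_subbundle_subspace[OF _ p] by blast
  have rad0: "0 \<in> radical M N i b p"
    using Stn unfolding direct_sum_def by blast
  have St_normal: "w \<in> normal_space M N i b p" if "w \<in> St p" for w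
  proof -
    have "0 + w \<in> {a + c |a c. a \<in> radical M N i b p \<and> c \<in> St p}"
      using rad0 that by blast
    then show ?thesis using Stn unfolding direct_sum_def by simp
  qed
  have Lspan: "L p = span ((\<lambda>j. n j p) ` {1..r})" using Lp pW by blast
  have L_sub: "subspace (L p)" unfolding Lspan by (rule subspace_span)
  show "subspace (transversal_space L St p)"
    unfolding transversal_space_def by (intro subspace_sums L_sub St_sub)
  show "tangent_image M N i p \<inter> transversal_space L St p \<subseteq> {0}"
  proof
    fix y assume y: "y \<in> tangent_image M N i p \<inter> transversal_space L St p"
    then obtain v w where v: "v \<in> L p" and w: "w \<in> St p" and yvw: "y = v + w"
      unfolding transversal_space_def by blast
    have vT: "v \<in> ?T"
    proof -
      have "(\<lambda>j. n j p) ` {1..r} \<subseteq> ?T" using n by blast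
      then have "span ((\<lambda>j. n j p) ` {1..r}) \<subseteq> ?T" using span_minimal T by blast
      then show ?thesis using v Lspan by blast
    qed
    have wN: "w \<in> normal_space M N i b p" by (rule St_normal[OF w])
    then have wT: "w \<in> ?T" unfolding normal_space_def perp_in_def by blast
    have "b (i p) (x j) v = 0" if j: "j \<in> {1..r}" for j
    proof -
      have "b (i p) (x j) w = b (i p) w (x j)"
        using sym xT[OF j] wT unfolding symmetric_on_def by blast
      also have "\<dots> = 0"
        using wN xt[OF j] unfolding normal_space_def perp_in_def by blast
      finally have "b (i p) (x j) w = 0" .
      moreover have "b (i p) (x j) (v + w) = b (i p) (x j) v + b (i p) (x j) w"
        by (rule linear_on_add[OF bilinear_on_right[OF b xT[OF j]] vT wT])
      moreover have "b (i p) (x j) (v + w) = 0"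
        using xn[OF j] y yvw by blast
      ultimately show ?thesis by simp
    qed
    moreover have "v = (\<Sum>j\<in>{1..r}. b (i p) (x j) v *\<^sub>R n j p)"
      using v Lspan by (intro span_dual_expansion[where V = ?T and e = "\<lambda>j. n j p"
            and \<alpha> = "\<lambda>j. b (i p) (x j)"] T n bilinear_on_right[OF b xT] dual) auto
    ultimately have "v = 0" by simp
    then have "y = w" using yvw by simp
    then have "y \<in> radical M N i b p"
      using y wN unfolding radical_def by blast
    then show "y \<in> {0}"
      using \<open>y = w\<close> w Stn unfolding direct_sum_def by blast
  qed
qed

text \<open>By the Gauss formula \<open>D\<^sub>x Y\<close> is the unique tangent vector that differs from the ambient derivative
  of \<open>Y\<close> by a transversal vector (the fact \<open>char\<close> in the proof).  Each law is verified by
  exhibiting the tangential and the transversal part of the ambient derivative.\<close>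

lemma induced_connection_is_connection:
  fixes M :: "('q, 'f::euclidean_space) manifold" and N :: "('p, 'e::euclidean_space) manifold"
  assumes M: "smooth_manifold M" and N: "smooth_manifold N" and imm: "immersed_submanifold M N i"
    and Dp: "connection_along M N i Dp" and ind: "induced_connection M N i Dp tr D h"
    and tr: "\<And>p. p \<in> points M \<Longrightarrow> subspace (tr p)"
      "\<And>p. p \<in> points M \<Longrightarrow> tangent_image M N i p \<inter> tr p \<subseteq> {0}"
  shows "connection_along M M (\<lambda>p. p) D"
proof -
  have i: "smooth_map M N i" and inj: "\<And>p. p \<in> points M \<Longrightarrow> inj_on (pushforward N i p) (tangent_space M p)"
    using imm unfolding immersed_submanifold_def by simp_all
  have unique: "a = c"
    if p: "p \<in> points M" and a: "a \<in> tangent_space M p" and c: "c \<in> tangent_space M p"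
      and k: "k \<in> tr p" and l: "l \<in> tr p"
      and eq: "pushforward N i p a + k = pushforward N i p c + l" for p a c k l
  proof -
    have ac: "a - c \<in> tangent_space M p"
      by (rule subspace_diff[OF subspace_tangent_space[OF M p] a c])
    have "pushforward N i p (a - c) = l - k"
      using arg_cong[OF eq, of "\<lambda>z. z - pushforward N i p c - k"]
      by (simp add: linear_diff[OF linear_pushforward])
    moreover have "pushforward N i p (a - c) \<in> tangent_image M N i p"
      unfolding tangent_image_def using ac by blast
    moreover have "l - k \<in> tr p" by (rule subspace_diff[OF tr(1)[OF p] l k])
    ultimately have "pushforward N i p (a - c) = 0" using tr(2)[OF p] by auto
    then have "pushforward N i p (a - c) = pushforward N i p 0"
      using linear_0[OF linear_pushforward] by metis
    then have "a - c = 0"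
      by (rule inj_onD[OF inj[OF p] _ ac subspace_0[OF subspace_tangent_space[OF M p]]])
    then show ?thesis by simp
  qed
  have gauss: "\<exists>k. D p x Y \<in> tangent_space M p \<and> k \<in> tr p
      \<and> Dp p x (\<lambda>q. pushforward N i q (Y q)) = pushforward N i p (D p x Y) + k"
    if x: "x \<in> tangent_space M p" and Y: "vector_field_near M p Y" for p x Y
  proof -
    obtain X where X: "vector_field_near M p X" "X p = x"
      by (rule tangent_vector_extends[OF M section_near_in_points[OF Y] x])
    obtain W where W: "p \<in> W" "vector_field_on M W X" "vector_field_on M W Y"
      by (rule vector_fields_near_common_domain[OF M X(1) Y])
    have *: "vector_field_on M W (\<lambda>p. D p (X p) Y)"
      "\<forall>p\<in>W. h p (X p) Y \<in> tr p \<and> Dp p (X p) (\<lambda>q. pushforward N i q (Y q)) =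
             pushforward N i p (D p (X p) Y) + h p (X p) Y"
      using ind W(2,3) unfolding induced_connection_def by blast+
    then show ?thesis
      using section_on_tangent[OF *(1) W(1)] W(1) X(2) by blast
  qed
  have char: "D p x Y = a"
    if x: "x \<in> tangent_space M p" and Y: "vector_field_near M p Y"
      and a: "a \<in> tangent_space M p" and k: "k \<in> tr p"
      and eq: "Dp p x (\<lambda>q. pushforward N i q (Y q)) = pushforward N i p a + k" for p x Y a k
  proof -
    obtain l where l: "D p x Y \<in> tangent_space M p" "l \<in> tr p"
      "Dp p x (\<lambda>q. pushforward N i q (Y q)) = pushforward N i p (D p x Y) + l"
      using gauss[OF x Y] by blast
    show ?thesis
      by (rule unique[OF section_near_in_points[OF Y] l(1) a l(2) k]) (use l(3) eq in simp)
  qed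
  note push = section_near_pushforward[OF M N i]
  show ?thesis
    unfolding connection_along_def
  proof (intro conjI allI impI ballI)
    show "vector_field_on M W (\<lambda>p. D p (X p) V)" if "vector_field_on M W X" "vector_field_on M W V" for W X V
      using ind that unfolding induced_connection_def by blast
  next
    fix p V assume p: "p \<in> points M" and V: "vector_field_near M p V"
    note T = subspace_tangent_space[OF M p]
    note lin = connection_linear[OF Dp push[OF V]]
    show "linear_on (tangent_space M p) (\<lambda>x. D p x V)"
      unfolding linear_on_def
    proof (intro conjI ballI allI)
      fix x y assume x: "x \<in> tangent_space M p" and y: "y \<in> tangent_space M p"
      obtain k where k: "D p x V \<in> tangent_space M p" "k \<in> tr p"
        "Dp p x (\<lambda>q. pushforward N i q (V q)) = pushforward N i p (D p x V) + k"
        using gauss[OF x V] by blast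
      obtain l where l: "D p y V \<in> tangent_space M p" "l \<in> tr p"
        "Dp p y (\<lambda>q. pushforward N i q (V q)) = pushforward N i p (D p y V) + l"
        using gauss[OF y V] by blast
      show "D p (x + y) V = D p x V + D p y V"
      proof (rule char[OF subspace_add[OF T x y] V subspace_add[OF T k(1) l(1)]
            subspace_add[OF tr(1)[OF p] k(2) l(2)]])
        show "Dp p (x + y) (\<lambda>q. pushforward N i q (V q))
            = pushforward N i p (D p x V + D p y V) + (k + l)"
          unfolding linear_on_add[OF lin x y] k(3) l(3) pushforward_add by (simp only: ac_simps)
      qed
    next
      fix c x assume x: "x \<in> tangent_space M p"
      obtain k where k: "D p x V \<in> tangent_space M p" "k \<in> tr p"
        "Dp p x (\<lambda>q. pushforward N i q (V q)) = pushforward N i p (D p x V) + k"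
        using gauss[OF x V] by blast
      show "D p (c *\<^sub>R x) V = c *\<^sub>R D p x V"
      proof (rule char[OF subspace_scale[OF T x] V subspace_scale[OF T k(1)]
            subspace_scale[OF tr(1)[OF p] k(2)]])
        show "Dp p (c *\<^sub>R x) (\<lambda>q. pushforward N i q (V q))
            = pushforward N i p (c *\<^sub>R D p x V) + c *\<^sub>R k"
          unfolding linear_on_scale[OF lin x] k(3) pushforward_scale by (simp only: scaleR_add_right)
      qed
    qed
  next
    fix p x V V'
    assume p: "p \<in> points M" and x: "x \<in> tangent_space M p"
      and V: "vector_field_near M p V" and V': "vector_field_near M p V'"
    obtain k where k: "D p x V \<in> tangent_space M p" "k \<in> tr p"
      "Dp p x (\<lambda>q. pushforward N i q (V q)) = pushforward N i p (D p x V) + k"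
      using gauss[OF x V] by blast
    obtain l where l: "D p x V' \<in> tangent_space M p" "l \<in> tr p"
      "Dp p x (\<lambda>q. pushforward N i q (V' q)) = pushforward N i p (D p x V') + l"
      using gauss[OF x V'] by blast
    show "D p x (\<lambda>q. V q + V' q) = D p x V + D p x V'"
    proof (rule char[OF x vector_field_near_add[OF M M V V']
          subspace_add[OF subspace_tangent_space[OF M p] k(1) l(1)]
          subspace_add[OF tr(1)[OF p] k(2) l(2)]])
      show "Dp p x (\<lambda>q. pushforward N i q (V q + V' q))
          = pushforward N i p (D p x V + D p x V') + (k + l)"
        unfolding pushforward_add connection_add[OF Dp x push[OF V] push[OF V']] k(3) l(3)
        by (simp only: ac_simps)
    qed
  next
    fix p x f V
    assume p: "p \<in> points M" and x: "x \<in> tangent_space M p"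
      and f: "smooth_near M p f" and V: "vector_field_near M p V"
    note T = subspace_tangent_space[OF M p]
    obtain k where k: "D p x V \<in> tangent_space M p" "k \<in> tr p"
      "Dp p x (\<lambda>q. pushforward N i q (V q)) = pushforward N i p (D p x V) + k"
      using gauss[OF x V] by blast
    have Vp: "V p \<in> tangent_space M p" by (rule section_near_tangent[OF V])
    show "D p x (\<lambda>q. f q *\<^sub>R V q) = x f *\<^sub>R V p + f p *\<^sub>R D p x V"
    proof (rule char[OF x vector_field_near_scale[OF M M f V]
          subspace_add[OF T subspace_scale[OF T Vp] subspace_scale[OF T k(1)]]
          subspace_scale[OF tr(1)[OF p] k(2)]])
      show "Dp p x (\<lambda>q. pushforward N i q (f q *\<^sub>R V q))
          = pushforward N i p (x f *\<^sub>R V p + f p *\<^sub>R D p x V) + f p *\<^sub>R k"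
        unfolding pushforward_add pushforward_scale connection_leibniz[OF Dp x f push[OF V]] k(3)
        by (simp only: scaleR_add_right ac_simps)
    qed
  next
    fix p x V V' W
    assume p: "p \<in> points M" and x: "x \<in> tangent_space M p"
      and V: "vector_field_near M p V" and V': "vector_field_near M p V'"
      and W: "openin (mtop M) W" "p \<in> W" "\<forall>q\<in>W. V q = V' q"
    obtain l where l: "D p x V' \<in> tangent_space M p" "l \<in> tr p"
      "Dp p x (\<lambda>q. pushforward N i q (V' q)) = pushforward N i p (D p x V') + l"
      using gauss[OF x V'] by blast
    have "Dp p x (\<lambda>q. pushforward N i q (V q)) = Dp p x (\<lambda>q. pushforward N i q (V' q))"
      using W(3) by (intro connection_cong[OF Dp x push[OF V] push[OF V'] W(1,2)]) simp
    then show "D p x V = D p x V'"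
      using l by (intro char[OF x V l(1,2)]) simp
  qed
qed


section \<open>The trace of the pseudo-Jacobi operator\<close>

theorem proposition4p8:
  fixes Mb :: "('p, 'e::euclidean_space) manifold"
    and M :: "('q, 'f::euclidean_space) manifold"
    and i :: "'q \<Rightarrow> 'p"
    and gb :: "'p metric_tensor"
    and m n r \<nu> :: nat
    and Db :: "('p, 'p) connection"
    and Dp :: "('q, 'p) connection"
    and D :: "('q, 'q) connection"
    and h :: "'q \<Rightarrow> 'q tvec \<Rightarrow> ('q \<Rightarrow> 'q tvec) \<Rightarrow> 'p tvec"
    and S St L :: "'q \<Rightarrow> 'p tvec set"
    and W :: "'q set"
    and \<xi> :: "nat \<Rightarrow> 'q \<Rightarrow> 'q tvec"
    and N :: "nat \<Rightarrow> 'q \<Rightarrow> 'p tvec"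
    and u :: 'q
    and x :: "'q tvec"
  defines "g \<equiv> induced_metric Mb i gb"
    and "gt \<equiv> associated_metric Mb i gb r N"
  assumes dims: "1 \<le> m" "1 \<le> n" "DIM('e) = m + n" "DIM('f) = m"
    and ambient: "smooth_manifold Mb" "semi_riemannian_metric Mb gb \<nu>" "1 \<le> \<nu>" "\<nu> < m + n"
    and connection: "levi_civita Mb gb Db"
    and submanifold: "smooth_manifold M" "lightlike_submanifold M Mb i gb r"
    and kind: "r < min m n \<or> r = n"
    and screen: "screen_distribution M Mb i gb S"
    and screen_transversal: "screen_transversal_bundle M Mb i gb St"
    and ltr: "lightlike_transversal_bundle M Mb i gb r S St L"
    and along: "pullback_connection M Mb i Db Dp"
    and gauss: "induced_connection M Mb i Dp (transversal_space L St) D h"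
    and algebraic: "algebraic_curvature M g D"
    and frame: "lightlike_frame M Mb i gb r S St W \<xi> N"
      "\<forall>p\<in>W. L p = span ((\<lambda>j. N j p) ` {1..r})"
    and u: "u \<in> W"
    and x: "x \<in> unit_vectors M g 1 u \<or> x \<in> unit_vectors M g (-1) u"
  shows "trace_on (tangent_space M u) (pseudo_jacobi M g gt D u x) =
    (\<Sum>j=1..r. eta Mb i gb N j u (curvature M D u x (\<xi> j u) x)) - ricci M D u x x"
proof -
  note M = submanifold(1) and Mb = ambient(1)
  let ?V = "tangent_space M u" and ?T = "tangent_space Mb (i u)" and ?b = "gb (i u)"
  let ?push = "pushforward Mb i u"
  have imm: "immersed_submanifold M Mb i"
    using submanifold(2) unfolding lightlike_submanifold_def by blast
  then have i: "smooth_map M Mb i" and inj: "\<And>p. p \<in> points M \<Longrightarrow> inj_on (pushforward Mb i p) (tangent_space M p)"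
    unfolding immersed_submanifold_def by simp_all
  note ip = smooth_map_in_points[OF M Mb i]
  have metric: "bilinear_on (tangent_space Mb p) (gb p)" "symmetric_on (tangent_space Mb p) (gb p)"
    if "p \<in> points Mb" for p
    using ambient(2) that unfolding semi_riemannian_metric_def by blast+
  have Dp: "connection_along M Mb i Dp"
    using along unfolding pullback_connection_def by blast
  have conn: "connection_along M M (\<lambda>p. p) D"
    using subspace_transversal_space[OF Mb ip _ metric[OF ip] screen_transversal ltr]
      tangent_transversal_disjoint[OF Mb ip _ metric[OF ip] screen_transversal ltr]
    by (intro induced_connection_is_connection[OF M Mb imm Dp gauss]) blast+
  have uM: "u \<in> points M"
    using frame(1) u openin_subset unfolding lightlike_frame_def by blast
  have xV: "x \<in> ?V" using x unfolding unit_vectors_def by blast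
  have V: "subspace ?V" by (rule subspace_tangent_space[OF M uM])
  obtain U \<phi> where c: "(U, \<phi>) \<in> atlas M" "u \<in> U"
    by (rule chart_exists[OF M uM])
  have \<xi>: "\<xi> j u \<in> ?V" and N: "N j u \<in> ?T" if "j \<in> {1..r}" for j
    using frame(1) that u section_on_tangent[of M M "\<lambda>p. p" W "\<xi> j" u]
      section_on_tangent[of M Mb i W "N j" u] unfolding lightlike_frame_def by blast+
  have push: "?push v \<in> ?T" if "v \<in> ?V" for v
    by (rule pushforward_tangent[OF M Mb i uM that])
  have lin: "linear_on ?V (\<lambda>v. ?b (?push v) t)" if "t \<in> ?T" for t
    unfolding linear_on_def pushforward_add pushforward_scale
    using linear_on_add[OF bilinear_on_left[OF metric(1)[OF ip[OF uM]] that]]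
      linear_on_scale[OF bilinear_on_left[OF metric(1)[OF ip[OF uM]] that]] push by simp
  have basis: "basis_family r (\<lambda>j. ?push (\<xi> j u)) (radical M Mb i gb u)"
    using frame(1) u unfolding lightlike_frame_def by blast
  have radical: "?push (\<xi> j u) \<in> radical M Mb i gb u" if "j \<in> {1..r}" for j
    using basis that span_base[of "?push (\<xi> j u)" "(\<lambda>j. ?push (\<xi> j u)) ` {1..r}"]
    unfolding basis_family_def by blast
  have dual: "?b (?push (\<xi> k u)) (N j u) = (if j = k then 1 else 0)"
    if "j \<in> {1..r}" "k \<in> {1..r}" for j k
    using frame(1) u that unfolding lightlike_frame_def by auto
  have R: "curvature M D u x y x \<in> ?V" if "y \<in> ?V" for y
    by (rule curvature_in_tangent_space[OF M conn uM xV that xV])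
  have "trace_on ?V (pseudo_jacobi M g gt D u x)
      = (\<Sum>j\<in>{1..r}. eta Mb i gb N j u (curvature M D u x (\<xi> j u) x))
        - trace_on ?V (\<lambda>y. curvature M D u x y x)"
  proof (rule trace_degenerate_jacobi[where g = "g u" and gt = "gt u"])
    show "subspace ?V" by fact
    show "finite (chart_vector M (U, \<phi>) u ` Basis)" by simp
    show "?V \<subseteq> span (chart_vector M (U, \<phi>) u ` Basis)"
      unfolding tangent_space_eq_span[OF M c] ..
    show "linear_on ?V (\<lambda>v. g u v w)" if "w \<in> ?V" for w
      unfolding g_def induced_metric_def by (rule lin[OF push[OF that]])
    show "g u v w = g u w v" if "v \<in> ?V" "w \<in> ?V" for v w
      using metric(2)[OF ip[OF uM]] push that
      unfolding g_def induced_metric_def symmetric_on_def by blast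
    show "linear_on ?V (eta Mb i gb N j u)" if "j \<in> {1..r}" for j
      unfolding eta_def by (rule lin[OF N[OF that]])
    show "\<xi> j u \<in> ?V" if "j \<in> {1..r}" for j by (rule \<xi>[OF that])
    show "g u (\<xi> j u) w = 0" if "j \<in> {1..r}" "w \<in> ?V" for j w
      using radical[OF that(1)] that(2)
      unfolding g_def induced_metric_def radical_def normal_space_def perp_in_def tangent_image_def
      by blast
    show "eta Mb i gb N j u (\<xi> k u) = (if j = k then 1 else 0)" if "j \<in> {1..r}" "k \<in> {1..r}" for j k
      unfolding eta_def by (rule dual[OF that])
    \<comment> \<open>a vector that \<open>g\<close> annihilates is radical, and the \<open>\<eta>\<^sub>j\<close> are its coefficients in the frame\<close>
    show "v = 0" if v: "v \<in> ?V" and g0: "\<And>w. w \<in> ?V \<Longrightarrow> g u v w = 0"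
      and \<eta>0: "\<And>j. j \<in> {1..r} \<Longrightarrow> eta Mb i gb N j u v = 0" for v
    proof -
      have "?push v \<in> radical M Mb i gb u"
        using v g0 push[OF v] unfolding radical_def normal_space_def perp_in_def tangent_image_def
          g_def induced_metric_def by blast
      then have "?push v \<in> span ((\<lambda>j. ?push (\<xi> j u)) ` {1..r})"
        using basis unfolding basis_family_def by blast
      then have "?push v = (\<Sum>j\<in>{1..r}. ?b (?push v) (N j u) *\<^sub>R ?push (\<xi> j u))"
        by (intro span_dual_expansion[OF subspace_tangent_space[OF Mb ip[OF uM]], where
              \<alpha> = "\<lambda>j y. ?b y (N j u)"] bilinear_on_left[OF metric(1)[OF ip[OF uM]] N]
            push \<xi> dual) auto
      then have "?push v = 0" using \<eta>0 unfolding eta_def by simp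
      then have "?push v = ?push 0" using linear_0[OF linear_pushforward] by metis
      then show ?thesis by (rule inj_onD[OF inj[OF uM] _ v subspace_0[OF V]])
    qed
    show "linear_on ?V (\<lambda>y. curvature M D u x y x)"
      by (rule curvature_linear2[OF M conn uM xV xV])
    show "curvature M D u x y x \<in> ?V" if "y \<in> ?V" for y by (rule R[OF that])
    show "gt u v w = g u v w + (\<Sum>j\<in>{1..r}. eta Mb i gb N j u v * eta Mb i gb N j u w)" for v w
      unfolding gt_def g_def associated_metric_def ..
    show "pseudo_jacobi M g gt D u x y
        = (THE v. v \<in> ?V \<and> (\<forall>w\<in>?V. gt u v w = - g u (curvature M D u x y x) w))"
      if y: "y \<in> ?V" for y
    proof -
      \<comment> \<open>antisymmetry in the first two slots turns \<open>R(y, x, x, w)\<close> into \<open>- g(R(x, y)x, w)\<close>\<close>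
      have "curvature4 M g D u y x x w = - curvature4 M g D u x y x w" if "w \<in> ?V" for w
        using algebraic[unfolded algebraic_curvature_def Let_def, rule_format,
            OF uM y xV xV that] by (elim conjE)
      then have "(\<forall>w\<in>?V. gt u v w = curvature4 M g D u y x x w)
          \<longleftrightarrow> (\<forall>w\<in>?V. gt u v w = - g u (curvature M D u x y x) w)" for v
        unfolding curvature4_def by simp
      then show ?thesis
        unfolding pseudo_jacobi_def by simp
    qed
  qed simp
  then show ?thesis unfolding ricci_def by simp
qed

end
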